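(* Let $d \ge 2$ be an integer and let $F$ be the free prosoluble group of rank $d$. Then $F$ is not FIG; that is, there is no finite subset $S\subseteq F$ that (topologically) invariably generates $F$.
   Context: A prosoluble group is an inverse limit of finite soluble groups (a profinite group all of whose finite continuous quotients are soluble). The free prosoluble group of rank $d$ is the free object on $d$ generators in the category of prosoluble groups, i.e. the pro-(finite soluble) completion of the abstract free group of rank $d$. For a profinite group $G$, generation is understood topologically: a subset generates $G$ if the abstract subgroup it generates is dense in $G$. A subset $S\subseteq G$ invariably generates $G$ if, for every choice of elements $g(s)\in G$ ($s\in S$), the set $\{s^{g(s)} \mid s\in S\}$ (where $s^{g}=g^{-1}sg$) topologically generates $G$. The group $G$ is called FIG if it is invariably generated by some finite subset. *)

theory Defs
  imports "HOL-Analysis.Analysis" "HOL-Algebra.Algebra"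
begin

text \<open>
  The letter \<open>(i, True)\<close> stands for the \<open>i\<close>-th free generator and \<open>(i, False)\<close> for its inverse.
  The elements of the free group of rank \<open>d\<close> are the reduced words over the generators
  \<open>0, \<dots>, d - 1\<close>.
\<close>

type_synonym letter = "nat \<times> bool"

definition inv_letter :: "letter \<Rightarrow> letter" where
  "inv_letter a = (fst a, \<not> snd a)"

definition reduced :: "letter list \<Rightarrow> bool" where
  "reduced w \<longleftrightarrow> successively (\<lambda>a b. b \<noteq> inv_letter a) w"

fun push_letter :: "letter \<Rightarrow> letter list \<Rightarrow> letter list" where
  "push_letter a [] = [a]"
| "push_letter a (b # w) = (if b = inv_letter a then w else a # b # w)"

definition free_group :: "nat \<Rightarrow> letter list monoid" where
  "free_group d =
     \<lparr>carrier = {w. reduced w \<and> fst ` set w \<subseteq> {..<d}},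
      mult = (\<lambda>u v. foldr push_letter u v),
      one = []\<rparr>"

lemma inv_letter_simps [simp]:
  "inv_letter (inv_letter a) = a" "fst (inv_letter a) = fst a" "inv_letter a \<noteq> a"
  by (auto simp: inv_letter_def prod_eq_iff)

lemma reduced_Nil [simp]: "reduced []"
  by (simp add: reduced_def)

lemma reduced_Cons:
  "reduced (a # w) \<longleftrightarrow> reduced w \<and> (w = [] \<or> hd w \<noteq> inv_letter a)"
  by (auto simp: reduced_def successively_Cons)

lemma reduced_push: "reduced w \<Longrightarrow> reduced (push_letter a w)"
  by (cases w) (auto simp: reduced_Cons)

lemma reduced_foldr_push: "reduced v \<Longrightarrow> reduced (foldr push_letter u v)"
  by (induction u) (auto intro: reduced_push)

lemma push_inv_push: "reduced w \<Longrightarrow> push_letter (inv_letter a) (push_letter a w) = w"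
  by (cases w rule: list.exhaust; cases "tl w") (auto simp: reduced_Cons)

lemma push_push_inv: "reduced w \<Longrightarrow> push_letter a (push_letter (inv_letter a) w) = w"
  using push_inv_push[of w "inv_letter a"] by simp

lemma foldr_push_push:
  "reduced w \<Longrightarrow> foldr push_letter (push_letter a u) w = push_letter a (foldr push_letter u w)"
  by (cases u) (auto simp: push_push_inv reduced_foldr_push)

lemma foldr_push_assoc:
  "reduced w \<Longrightarrow>
    foldr push_letter (foldr push_letter u v) w = foldr push_letter u (foldr push_letter v w)"
  by (induction u) (auto simp: foldr_push_push)

lemma foldr_push_reduced: "reduced w \<Longrightarrow> foldr push_letter w [] = w"
proof (induction w)
  case (Cons a w)
  then show ?case by (cases w) (auto simp: reduced_Cons)
qed simp

lemma set_push: "set (push_letter a w) \<subseteq> insert a (set w)"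
  by (cases w) auto

lemma set_foldr_push: "set (foldr push_letter u v) \<subseteq> set u \<union> set v"
  by (induction u) (use set_push in fastforce)+

lemma foldr_push_left_inverse:
  assumes "reduced w"
  shows "foldr push_letter (foldr push_letter (rev (map inv_letter w)) []) w = []"
proof -
  have "foldr push_letter (rev (map inv_letter u)) (foldr push_letter u v) = v"
    if "reduced v" for u v
    using that
    by (induction u) (auto simp: push_inv_push reduced_foldr_push)
  from this[of "[]" w] show ?thesis
    using assms by (simp add: foldr_push_assoc foldr_push_reduced)
qed

lemma group_free_group: "group (free_group d)"
proof (rule groupI)
  fix u assume u: "u \<in> carrier (free_group d)"
  let ?v = "foldr push_letter (rev (map inv_letter u)) []"
  have "?v \<in> carrier (free_group d)"
    using u set_foldr_push[of "rev (map inv_letter u)" "[]"]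
    by (fastforce simp: free_group_def reduced_foldr_push)
  moreover have "?v \<otimes>\<^bsub>free_group d\<^esub> u = \<one>\<^bsub>free_group d\<^esub>"
    using u by (simp add: free_group_def foldr_push_left_inverse)
  ultimately show "\<exists>v\<in>carrier (free_group d). v \<otimes>\<^bsub>free_group d\<^esub> u = \<one>\<^bsub>free_group d\<^esub>"
    by blast
next
  fix u v assume "u \<in> carrier (free_group d)" "v \<in> carrier (free_group d)"
  then show "u \<otimes>\<^bsub>free_group d\<^esub> v \<in> carrier (free_group d)"
    using set_foldr_push[of u v] by (fastforce simp: free_group_def reduced_foldr_push)
qed (auto simp: free_group_def foldr_push_assoc)

lemma free_group_lift:
  assumes "group H" and h: "\<And>i. i < d \<Longrightarrow> h i \<in> carrier H"
  shows "\<exists>!f. f \<in> extensional (carrier (free_group d)) \<and> f \<in> hom (free_group d) H \<and>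
              (\<forall>i<d. f [(i, True)] = h i)"
proof -
  interpret H: group H by fact
  interpret F: group "free_group d" by (rule group_free_group)
  define l where "l a = (if snd a then h (fst a) else inv\<^bsub>H\<^esub> h (fst a))" for a
  define L where "L w = foldr (\<lambda>a x. l a \<otimes>\<^bsub>H\<^esub> x) w \<one>\<^bsub>H\<^esub>" for w
  have l: "l a \<in> carrier H" "l (inv_letter a) = inv\<^bsub>H\<^esub> l a" if "fst a < d" for a
    using that h by (auto simp: l_def inv_letter_def)
  have L: "L w \<in> carrier H" if "fst ` set w \<subseteq> {..<d}" for w
    using that by (induction w) (auto simp: L_def l)
  have L_Cons: "L (a # w) = l a \<otimes>\<^bsub>H\<^esub> L w" for a w
    by (simp add: L_def)
  have L_push: "L (push_letter a w) = l a \<otimes>\<^bsub>H\<^esub> L w"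
    if "fst ` set (a # w) \<subseteq> {..<d}" for a w
    using that
    by (cases w) (auto simp: L_Cons l L H.m_assoc[symmetric])
  have L_mult: "L (foldr push_letter u v) = L u \<otimes>\<^bsub>H\<^esub> L v"
    if "fst ` set u \<subseteq> {..<d}" "fst ` set v \<subseteq> {..<d}" for u v
    using that
  proof (induction u)
    case Nil
    then show ?case using L[of v] by (simp add: L_def)
  next
    case (Cons a u)
    have "fst ` set (a # foldr push_letter u v) \<subseteq> {..<d}"
      using Cons.prems set_foldr_push[of u v] by fastforce
    then show ?case
      using Cons by (simp add: L_push L_Cons l L H.m_assoc)
  qed
  let ?f = "restrict L (carrier (free_group d))"
  have f: "?f \<in> hom (free_group d) H"
  proof (rule homI)
    fix u v assume uv: "u \<in> carrier (free_group d)" "v \<in> carrier (free_group d)"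
    then show "?f (u \<otimes>\<^bsub>free_group d\<^esub> v) = ?f u \<otimes>\<^bsub>H\<^esub> ?f v"
      using F.m_closed[OF uv] by (simp add: free_group_def L_mult)
  qed (auto simp: free_group_def L)
  have gen: "?f [(i, True)] = h i" if "i < d" for i
    using that h[OF that] by (simp add: free_group_def L_def l_def reduced_Cons)
  have uniq: "g = ?f"
    if g: "g \<in> extensional (carrier (free_group d))" "g \<in> hom (free_group d) H"
      "\<forall>i<d. g [(i, True)] = h i" for g
  proof -
    interpret g: group_hom "free_group d" H g
      by unfold_locales (rule g)
    have gl: "g [a] = l a" if a: "fst a < d" for a
    proof (cases "snd a")
      case True
      then show ?thesis using g(3) a by (cases a) (auto simp: l_def)
    next
      case False
      let ?b = "inv_letter a"
      have b: "?b = (fst a, True)" using False by (simp add: inv_letter_def)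
      have ca: "[a] \<in> carrier (free_group d)" "[?b] \<in> carrier (free_group d)"
        using a by (auto simp: free_group_def reduced_Cons)
      have "[a] \<otimes>\<^bsub>free_group d\<^esub> [?b] = \<one>\<^bsub>free_group d\<^esub>"
        by (simp add: free_group_def)
      then have "g [a] \<otimes>\<^bsub>H\<^esub> g [?b] = \<one>\<^bsub>H\<^esub>"
        using g.hom_mult[OF ca] by simp
      then have "g [a] = inv\<^bsub>H\<^esub> g [?b]"
        using ca by (intro H.inv_equality[symmetric]) auto
      then show ?thesis
        using False g(3) a b by (simp add: l_def)
    qed
    have "g w = L w" if "w \<in> carrier (free_group d)" for w
      using that
    proof (induction w)
      case Nil
      then show ?case using g.hom_one by (simp add: L_def free_group_def)
    next
      case (Cons a w)
      have c: "[a] \<in> carrier (free_group d)" "w \<in> carrier (free_group d)"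
        using Cons.prems by (auto simp: free_group_def reduced_Cons)
      have "a # w = [a] \<otimes>\<^bsub>free_group d\<^esub> w"
        using Cons.prems by (cases w) (auto simp: free_group_def reduced_Cons)
      then have "g (a # w) = g [a] \<otimes>\<^bsub>H\<^esub> g w"
        using g.hom_mult[OF c] by simp
      then show ?case
        using Cons.IH[OF c(2)] gl[of a] Cons.prems by (simp add: L_Cons free_group_def)
    qed
    then show ?thesis
      using g(1) by (intro extensionalityI[of g "carrier (free_group d)"]) auto
  qed
  show ?thesis
    using f gen uniq by (intro ex1I[of _ ?f]) auto
qed

definition finite_soluble_quotients :: "('a, 'b) monoid_scheme \<Rightarrow> 'a set set" where
  "finite_soluble_quotients G =
     {N. N \<lhd> G \<and> finite (carrier (G Mod N)) \<and> solvable (G Mod N)}"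

text \<open>
  The inverse limit of the quotients \<open>G Mod N\<close>, inside their full product. For \<open>N \<subseteq> M\<close> the
  transition map \<open>G Mod N \<rightarrow> G Mod M\<close> sends a coset \<open>C\<close> of \<open>N\<close> to the coset \<open>M <#> C\<close> of \<open>M\<close>.
\<close>

definition prosoluble_completion ::
    "('a, 'b) monoid_scheme \<Rightarrow> ('a set \<Rightarrow> 'a set) monoid" where
  "prosoluble_completion G =
     (product_group (finite_soluble_quotients G) (\<lambda>N. G Mod N))
       \<lparr>carrier :=
         {x \<in> \<Pi>\<^sub>E N\<in>finite_soluble_quotients G. carrier (G Mod N).
            \<forall>N\<in>finite_soluble_quotients G. \<forall>M\<in>finite_soluble_quotients G.
              N \<subseteq> M \<longrightarrow> M <#>\<^bsub>G\<^esub> x N = x M}\<rparr>"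

definition prosoluble_completion_topology ::
    "('a, 'b) monoid_scheme \<Rightarrow> ('a set \<Rightarrow> 'a set) topology" where
  "prosoluble_completion_topology G =
     subtopology
       (product_topology (\<lambda>N. discrete_topology (carrier (G Mod N))) (finite_soluble_quotients G))
       (carrier (prosoluble_completion G))"

lemma transition_hom:
  assumes N: "N \<lhd> G" and M: "M \<lhd> G" and "N \<subseteq> M"
  shows "(\<lambda>C. M <#>\<^bsub>G\<^esub> C) \<in> hom (G Mod N) (G Mod M)"
    and "g \<in> carrier G \<Longrightarrow> M <#>\<^bsub>G\<^esub> (N #>\<^bsub>G\<^esub> g) = M #>\<^bsub>G\<^esub> g"
proof -
  interpret N: normal N G by fact
  interpret M: normal M G by fact
  have MN: "M <#>\<^bsub>G\<^esub> N = M"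
  proof
    show "M <#>\<^bsub>G\<^esub> N \<subseteq> M"
      using \<open>N \<subseteq> M\<close> by (auto simp: set_mult_def)
    show "M \<subseteq> M <#>\<^bsub>G\<^esub> N"
      using M.subset by (force simp: set_mult_def intro: bexI[of _ "\<one>\<^bsub>G\<^esub>"])
  qed
  show *: "M <#>\<^bsub>G\<^esub> (N #>\<^bsub>G\<^esub> g) = M #>\<^bsub>G\<^esub> g" if "g \<in> carrier G" for g
    using that M.subset N.subset by (simp add: N.setmult_rcos_assoc MN)
  show "(\<lambda>C. M <#>\<^bsub>G\<^esub> C) \<in> hom (G Mod N) (G Mod M)"
  proof (rule homI)
    fix C assume "C \<in> carrier (G Mod N)"
    then show "M <#>\<^bsub>G\<^esub> C \<in> carrier (G Mod M)"
      by (auto simp: FactGroup_def RCOSETS_def *)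
  next
    fix C D assume "C \<in> carrier (G Mod N)" "D \<in> carrier (G Mod N)"
    then show "M <#>\<^bsub>G\<^esub> (C \<otimes>\<^bsub>G Mod N\<^esub> D) = (M <#>\<^bsub>G\<^esub> C) \<otimes>\<^bsub>G Mod M\<^esub> (M <#>\<^bsub>G\<^esub> D)"
      by (auto simp: FactGroup_def RCOSETS_def * N.rcos_sum M.rcos_sum)
  qed
qed

lemma group_prosoluble_completion:
  assumes "group G"
  shows "group (prosoluble_completion G)"
proof -
  interpret G: group G by fact
  let ?I = "finite_soluble_quotients G"
  let ?P = "product_group ?I (\<lambda>N. G Mod N)"
  have normal: "N \<lhd> G" if "N \<in> ?I" for N
    using that by (simp add: finite_soluble_quotients_def)
  have gr: "group (G Mod N)" if "N \<in> ?I" for N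
    using normal[OF that] by (rule normal.factorgroup_is_group)
  interpret P: group ?P by (simp add: gr)
  have hom: "group_hom (G Mod N) (G Mod M) (\<lambda>C. M <#>\<^bsub>G\<^esub> C)"
    if "N \<in> ?I" "M \<in> ?I" "N \<subseteq> M" for N M
    using that by (intro group_hom.intro group_hom_axioms.intro gr transition_hom normal)
  have "subgroup (carrier (prosoluble_completion G)) ?P"
  proof (rule P.subgroupI)
    show "carrier (prosoluble_completion G) \<subseteq> carrier ?P"
      by (auto simp: prosoluble_completion_def)
    have "\<one>\<^bsub>?P\<^esub> \<in> carrier (prosoluble_completion G)"
      using group_hom.hom_one[OF hom] P.one_closed
      by (auto simp: prosoluble_completion_def)
    then show "carrier (prosoluble_completion G) \<noteq> {}"
      by blast
  next
    fix x assume x: "x \<in> carrier (prosoluble_completion G)"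
    then have "inv\<^bsub>?P\<^esub> x \<in> carrier ?P"
      by (intro P.inv_closed) (auto simp: prosoluble_completion_def)
    moreover have "inv\<^bsub>?P\<^esub> x = (\<lambda>N\<in>?I. inv\<^bsub>G Mod N\<^esub> x N)"
      using x by (intro inv_product_group gr) (auto simp: prosoluble_completion_def)
    ultimately show "inv\<^bsub>?P\<^esub> x \<in> carrier (prosoluble_completion G)"
      using x group_hom.hom_inv[OF hom]
      by (auto simp: prosoluble_completion_def PiE_iff)
  next
    fix x y
    assume xy: "x \<in> carrier (prosoluble_completion G)" "y \<in> carrier (prosoluble_completion G)"
    then have "x \<otimes>\<^bsub>?P\<^esub> y \<in> carrier ?P"
      by (intro P.m_closed) (auto simp: prosoluble_completion_def)
    then show "x \<otimes>\<^bsub>?P\<^esub> y \<in> carrier (prosoluble_completion G)"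
      using xy group_hom.hom_mult[OF hom]
      by (auto simp: prosoluble_completion_def PiE_iff)
  qed
  from P.subgroup_imp_group[OF this] show ?thesis
    by (simp add: prosoluble_completion_def)
qed

lemma topspace_prosoluble_completion [simp]:
  "topspace (prosoluble_completion_topology G) = carrier (prosoluble_completion G)"
  by (auto simp: prosoluble_completion_topology_def prosoluble_completion_def)

definition free_prosoluble_group ::
    "nat \<Rightarrow> (letter list set \<Rightarrow> letter list set) monoid" where
  "free_prosoluble_group d = prosoluble_completion (free_group d)"

definition free_prosoluble_topology ::
    "nat \<Rightarrow> (letter list set \<Rightarrow> letter list set) topology" where
  "free_prosoluble_topology d = prosoluble_completion_topology (free_group d)"

definition topologically_generates ::
    "('a, 'b) monoid_scheme \<Rightarrow> 'a topology \<Rightarrow> 'a set \<Rightarrow> bool" where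
  "topologically_generates G T S \<longleftrightarrow>
     S \<subseteq> carrier G \<and> T closure_of (generate G S) = carrier G"

definition invariably_generates ::
    "('a, 'b) monoid_scheme \<Rightarrow> 'a topology \<Rightarrow> 'a set \<Rightarrow> bool" where
  "invariably_generates G T S \<longleftrightarrow>
     S \<subseteq> carrier G \<and>
     (\<forall>g \<in> S \<rightarrow> carrier G.
        topologically_generates G T ((\<lambda>s. inv\<^bsub>G\<^esub> g s \<otimes>\<^bsub>G\<^esub> s \<otimes>\<^bsub>G\<^esub> g s) ` S))"

definition FIG :: "('a, 'b) monoid_scheme \<Rightarrow> 'a topology \<Rightarrow> bool" where
  "FIG G T \<longleftrightarrow> (\<exists>S. finite S \<and> invariably_generates G T S)"

end

theory Submission
  imports Defs "HOL-Library.Function_Algebras" "HOL-Number_Theory.Cong"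
begin

text \<open>
  A finite invariably generating set of \<open>k\<close> elements would map onto an invariably generating family
  of \<open>k\<close> elements in every finite soluble quotient of the free group, because the fibres of the
  projections are open (\<open>FIG_prosoluble_completion_imp\<close>). So it suffices to find, for each \<open>k\<close>, a
  finite soluble \<open>d\<close>-generated group in which no \<open>k\<close> elements generate invariably. Such groups arise
  by iterated extension.

  Let \<open>H\<close> be a finite soluble quotient of the free group of rank \<open>d \<ge> 2\<close> and \<open>p\<close> a prime not dividing
  its order. The relation module of \<open>H\<close> modulo \<open>p\<close> has a quotient \<open>M\<close> of dimension at least \<open>|H|\<close>
  over \<open>\<F>\<^sub>p\<close>, and the extension of \<open>H\<close> by \<open>M\<close>, still a quotient of the free group, splits as a
  semidirect product (\<open>large_split_extension\<close>).

  Suppose \<open>k\<close> elements \<open>(b\<^sub>i, h\<^sub>i)\<close> are given in the extension. Conjugation by \<open>M\<close> makes each \<open>b\<^sub>i\<close> a fixed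
  point of \<open>h\<^sub>i\<close>, and then the submodule generated by \<open>b\<^sub>i\<close> is a quotient of the permutation module on
  the cosets of \<open>\<langle>h\<^sub>i\<rangle>\<close>: its dimension is at most \<open>|H|\<close> divided by the order of \<open>h\<^sub>i\<close>. If all the
  orders exceed \<open>k\<close>, the \<open>k\<close> submodules do not span \<open>M\<close>, and the conjugates generate a proper subgroup
  (\<open>not_invariable_generators_semidirect\<close>).

  The induction in \<open>quotient_without_invariable_generators\<close> takes care of the elements of small order.
  Call \<open>g\<close> short if \<open>g ^ N = 1\<close>. The claim for \<open>l\<close> is that, for every \<open>N\<close>, some quotient is not invariably
  generated by \<open>k\<close> elements fewer than \<open>l\<close> of which are not short. To pass from \<open>l\<close> to \<open>l + 1\<close>, apply
  the claim with the larger exponent \<open>N * fact k\<close> to obtain \<open>H\<close>, and extend it by a module whose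
  characteristic \<open>p\<close> does not divide \<open>N\<close>. Once \<open>b\<^sub>i\<close> is fixed by \<open>h\<^sub>i\<close>, a short element
  satisfies \<open>b\<^sub>i ^ N = 1 = b\<^sub>i ^ p\<close>, so \<open>b\<^sub>i = 1\<close> and it contributes nothing to the span. The
  images in \<open>H\<close> of the remaining ones, at most \<open>l\<close> in number, must all have order larger than \<open>k\<close>,
  which is the situation just excluded. For \<open>l = k + 1\<close> the claim concerns all families of \<open>k\<close> elements.
\<close>


section \<open>Spans in a commutative monoid of exponent \<open>p\<close>\<close>

definition power_span :: "'b::comm_monoid_mult set \<Rightarrow> 'b set" where
  "power_span S = range (\<lambda>e :: 'b \<Rightarrow> nat. \<Prod>s\<in>S. s ^ e s)"

lemma power_span_superset:
  assumes "finite S" "s \<in> S"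
  shows "s \<in> power_span S"
proof -
  have "(\<Prod>t\<in>S. t ^ (if t = s then 1 else 0)) = (\<Prod>t\<in>S. if t = s then t else 1)"
    by (intro prod.cong) auto
  also have "\<dots> = s"
    using assms by (simp add: prod.delta)
  finally have "s = (\<Prod>t\<in>S. t ^ (if t = s then 1 else 0))" by (rule sym)
  then show ?thesis
    unfolding power_span_def by (rule range_eqI[where x = "\<lambda>t. if t = s then 1 else 0"])
qed

lemma one_in_power_span: "1 \<in> power_span S"
proof -
  have "1 = (\<Prod>s\<in>S. s ^ 0)" by simp
  then show ?thesis unfolding power_span_def by (rule range_eqI[where x = "\<lambda>_. 0"])
qed

lemma mult_in_power_span:
  assumes "x \<in> power_span S" "y \<in> power_span S"
  shows "x * y \<in> power_span S"
proof -
  obtain e f where "x = (\<Prod>s\<in>S. s ^ e s)" "y = (\<Prod>s\<in>S. s ^ f s)"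
    using assms by (auto simp: power_span_def)
  then have "x * y = (\<Prod>s\<in>S. s ^ (e s + f s))"
    by (simp add: prod.distrib power_add)
  then show ?thesis unfolding power_span_def by (rule range_eqI[where x = "\<lambda>s. e s + f s"])
qed

lemma power_mod_exponent:
  fixes x :: "'b::comm_monoid_mult"
  assumes "x ^ p = 1"
  shows "x ^ n = x ^ (n mod p)"
proof -
  have "x ^ n = x ^ (p * (n div p) + n mod p)" by simp
  also have "\<dots> = x ^ (n mod p)" unfolding power_add power_mult assms by simp
  finally show ?thesis .
qed

lemma power_closed:
  fixes x :: "'b::comm_monoid_mult"
  assumes "1 \<in> M" "\<And>x y. x \<in> M \<Longrightarrow> y \<in> M \<Longrightarrow> x * y \<in> M" "x \<in> M"
  shows "x ^ n \<in> M"
  using assms by (induction n) auto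

lemma prod_closed:
  fixes f :: "'i \<Rightarrow> 'b::comm_monoid_mult"
  assumes "1 \<in> M" "\<And>x y. x \<in> M \<Longrightarrow> y \<in> M \<Longrightarrow> x * y \<in> M" "\<And>i. i \<in> I \<Longrightarrow> f i \<in> M"
  shows "(\<Prod>i\<in>I. f i) \<in> M"
  using assms by (induction I rule: infinite_finite_induct) auto

lemma power_of_prod:
  fixes f :: "'i \<Rightarrow> 'b::comm_monoid_mult"
  shows "(\<Prod>i\<in>I. f i) ^ n = (\<Prod>i\<in>I. f i ^ n)"
  by (induction I rule: infinite_finite_induct) (auto simp: power_mult_distrib)

lemma power_span_least:
  assumes "1 \<in> M" "\<And>x y. x \<in> M \<Longrightarrow> y \<in> M \<Longrightarrow> x * y \<in> M" "S \<subseteq> M"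
  shows "power_span S \<subseteq> M"
  unfolding power_span_def using assms by (auto intro!: prod_closed power_closed)

text \<open>
  Exponents matter only modulo \<open>p\<close>, so \<open>r\<close> elements span at most \<open>p ^ r\<close>. All the dimension
  counts below are instances of this bound.
\<close>

lemma power_span_card:
  assumes "finite S" "p > 0" and pow: "\<And>s. s \<in> S \<Longrightarrow> s ^ p = 1"
  shows "finite (power_span S)" "card (power_span S) \<le> p ^ card S"
proof -
  let ?E = "S \<rightarrow>\<^sub>E {..<p}"
  let ?f = "\<lambda>e. \<Prod>s\<in>S. s ^ e s"
  have "power_span S \<subseteq> ?f ` ?E"
  proof
    fix x assume "x \<in> power_span S"
    then obtain e where "x = (\<Prod>s\<in>S. s ^ e s)" by (auto simp: power_span_def)
    also have "\<dots> = ?f (\<lambda>s\<in>S. e s mod p)"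
      by (intro prod.cong) (auto simp: power_mod_exponent[OF pow, symmetric])
    finally have "x = ?f (\<lambda>s\<in>S. e s mod p)" .
    then show "x \<in> ?f ` ?E"
      using \<open>p > 0\<close> by (intro image_eqI[where x = "\<lambda>s\<in>S. e s mod p"]) auto
  qed
  moreover have fin: "finite ?E" by (intro finite_PiE assms) auto
  ultimately show "finite (power_span S)" by (meson finite_subset finite_imageI)
  have "card (power_span S) \<le> card (?f ` ?E)"
    using fin \<open>power_span S \<subseteq> _\<close> by (intro card_mono) auto
  also have "\<dots> \<le> card ?E" by (rule card_image_le[OF fin])
  also have "\<dots> = p ^ card S" using \<open>finite S\<close> by (simp add: card_PiE)
  finally show "card (power_span S) \<le> p ^ card S" .
qed


section \<open>Modules of exponent \<open>p\<close> over a finite group of order prime to \<open>p\<close>\<close>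

text \<open>
  An \<open>\<F>\<^sub>p H\<close>-module, written multiplicatively inside some commutative monoid. Inverses are the
  powers with exponent \<open>p - 1\<close>, and scalars are exponents.
\<close>

locale coprime_module = group H for H :: "('a, 'm) monoid_scheme" (structure) +
  fixes p :: nat and B :: "'b::comm_monoid_mult set" and act :: "'a \<Rightarrow> 'b \<Rightarrow> 'b"
  assumes finite_group: "finite (carrier H)"
    and prime_p: "Factorial_Ring.prime p"
    and coprime_p: "coprime p (card (carrier H))"
    and finite_module: "finite B"
    and one_closed_B: "1 \<in> B"
    and mult_closed_B: "\<lbrakk>x \<in> B; y \<in> B\<rbrakk> \<Longrightarrow> x * y \<in> B"
    and power_p: "x \<in> B \<Longrightarrow> x ^ p = 1"
    and act_closed: "\<lbrakk>h \<in> carrier H; x \<in> B\<rbrakk> \<Longrightarrow> act h x \<in> B"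
    and act_mult: "\<lbrakk>h \<in> carrier H; x \<in> B; y \<in> B\<rbrakk> \<Longrightarrow> act h (x * y) = act h x * act h y"
    and act_id: "x \<in> B \<Longrightarrow> act \<one> x = x"
    and act_act: "\<lbrakk>h \<in> carrier H; k \<in> carrier H; x \<in> B\<rbrakk> \<Longrightarrow> act h (act k x) = act (h \<otimes> k) x"

definition semidirect ::
    "('a, 'm) monoid_scheme \<Rightarrow> 'b::comm_monoid_mult set \<Rightarrow> ('a \<Rightarrow> 'b \<Rightarrow> 'b) \<Rightarrow> ('b \<times> 'a) monoid" where
  "semidirect H B act =
     \<lparr>carrier = B \<times> carrier H,
      mult = (\<lambda>(x, h) (y, k). (x * act h y, h \<otimes>\<^bsub>H\<^esub> k)),
      one = (1, \<one>\<^bsub>H\<^esub>)\<rparr>"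

lemma semidirect_simps [simp]:
  "carrier (semidirect H B act) = B \<times> carrier H"
  "(x, h) \<otimes>\<^bsub>semidirect H B act\<^esub> (y, k) = (x * act h y, h \<otimes>\<^bsub>H\<^esub> k)"
  "\<one>\<^bsub>semidirect H B act\<^esub> = (1, \<one>\<^bsub>H\<^esub>)"
  by (simp_all add: semidirect_def)

context coprime_module
begin

lemma p_pos: "p > 0"
  using prime_p by (simp add: prime_gt_0_nat)

lemma power_closed_B: "x \<in> B \<Longrightarrow> x ^ n \<in> B"
  by (rule power_closed) (auto intro: one_closed_B mult_closed_B)

lemma prod_closed_B: "(\<And>i. i \<in> I \<Longrightarrow> f i \<in> B) \<Longrightarrow> (\<Prod>i\<in>I. f i) \<in> B"
  by (rule prod_closed) (auto intro: one_closed_B mult_closed_B)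

definition minv :: "'b \<Rightarrow> 'b" where "minv x = x ^ (p - 1)"

lemma minv_closed: "x \<in> B \<Longrightarrow> minv x \<in> B"
  by (simp add: minv_def power_closed_B)

lemma minv_left: "x \<in> B \<Longrightarrow> minv x * x = 1"
  using power_p[of x] p_pos power_minus_mult[of p x] by (simp add: minv_def)

lemma minv_right: "x \<in> B \<Longrightarrow> x * minv x = 1"
  using minv_left by (simp add: mult.commute)

lemma power_cong:
  assumes "x \<in> B" "[m = n] (mod p)"
  shows "x ^ m = x ^ n"
proof -
  have "x ^ i = x ^ (i mod p)" for i
    by (rule power_mod_exponent[OF power_p[OF assms(1)]])
  from this[of m] this[of n] show ?thesis using assms(2) by (simp add: cong_def)
qed

lemma act_one: assumes h: "h \<in> carrier H" shows "act h 1 = 1"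
proof -
  have c: "act h 1 \<in> B" using h by (simp add: act_closed one_closed_B)
  have "act h 1 * act h 1 = act h 1"
    using act_mult[OF h one_closed_B one_closed_B] by simp
  then have "act h 1 * act h 1 * minv (act h 1) = act h 1 * minv (act h 1)" by simp
  then show ?thesis using minv_right[OF c] by (simp add: mult.assoc)
qed

lemma act_power: "\<lbrakk>h \<in> carrier H; x \<in> B\<rbrakk> \<Longrightarrow> act h (x ^ n) = act h x ^ n"
  by (induction n) (auto simp: act_one act_mult power_closed_B)

lemma act_prod:
  assumes h: "h \<in> carrier H" and "\<And>i. i \<in> I \<Longrightarrow> f i \<in> B"
  shows "act h (\<Prod>i\<in>I. f i) = (\<Prod>i\<in>I. act h (f i))"
  using assms(2)
  by (induction I rule: infinite_finite_induct) (auto simp: act_one[OF h] act_mult[OF h] prod_closed_B)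

text \<open>
  Since \<open>p\<close> does not divide \<open>card (carrier H)\<close>, one may divide by the group order: this exponent is
  what makes averages over \<open>H\<close> available.
\<close>

lemma inverse_of_group_order:
  obtains r where "\<And>x. x \<in> B \<Longrightarrow> (x ^ card (carrier H)) ^ r = x"
proof -
  obtain r where r: "[card (carrier H) * r = 1] (mod p)"
    using coprime_p cong_solve_coprime_nat[of "card (carrier H)" p] by (auto simp: coprime_commute)
  have "(x ^ card (carrier H)) ^ r = x" if "x \<in> B" for x
    using power_cong[OF that r] by (simp add: power_mult)
  then show ?thesis by (rule that)
qed

lemma group_semidirect: "group (semidirect H B act)"
proof (rule groupI)
  fix x assume "x \<in> carrier (semidirect H B act)"
  then obtain b h where x: "x = (b, h)" "b \<in> B" "h \<in> carrier H" by auto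
  have "(act (inv h) (minv b), inv h) \<otimes>\<^bsub>semidirect H B act\<^esub> x = \<one>\<^bsub>semidirect H B act\<^esub>"
    using x by (simp add: act_mult[symmetric] minv_closed minv_left act_one)
  moreover have "(act (inv h) (minv b), inv h) \<in> carrier (semidirect H B act)"
    using x by (simp add: act_closed minv_closed)
  ultimately show "\<exists>y\<in>carrier (semidirect H B act).
      y \<otimes>\<^bsub>semidirect H B act\<^esub> x = \<one>\<^bsub>semidirect H B act\<^esub>" by blast
qed (auto simp: one_closed_B mult_closed_B act_closed act_mult act_act act_id m_assoc mult.assoc)

sublocale SD: group "semidirect H B act"
  by (rule group_semidirect)

lemma finite_semidirect: "finite (carrier (semidirect H B act))"
  by (simp add: finite_module finite_group)

lemma snd_hom: "snd \<in> hom (semidirect H B act) H"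
  by (rule homI) auto

lemma snd_power:
  "x \<in> carrier (semidirect H B act) \<Longrightarrow> snd (x [^]\<^bsub>semidirect H B act\<^esub> (n::nat)) = snd x [^] n"
  by (induction n) (auto simp: semidirect_def split: prod.splits)

lemma inv_module_element:
  "u \<in> B \<Longrightarrow> inv\<^bsub>semidirect H B act\<^esub> (u, \<one>) = (minv u, \<one>)"
  by (intro SD.inv_equality) (auto simp: minv_left minv_closed act_id)

lemma submodule:
  assumes "M \<subseteq> B" "1 \<in> M" "\<And>x y. x \<in> M \<Longrightarrow> y \<in> M \<Longrightarrow> x * y \<in> M"
    "\<And>h x. h \<in> carrier H \<Longrightarrow> x \<in> M \<Longrightarrow> act h x \<in> M"
  shows "coprime_module H p M act"
proof (intro coprime_module.intro coprime_module_axioms.intro)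
  show "finite M" using assms(1) finite_module by (rule finite_subset)
qed (use assms in \<open>auto simp: is_group finite_group prime_p coprime_p power_p act_mult act_id act_act subset_iff\<close>)

lemma subgroup_semidirect:
  assumes "coprime_module H p M act" "M \<subseteq> B"
  shows "subgroup (M \<times> carrier H) (semidirect H B act)"
proof (rule SD.group_incl_imp_subgroup)
  have "(semidirect H B act)\<lparr>carrier := M \<times> carrier H\<rparr> = semidirect H M act"
    by (simp add: semidirect_def)
  then show "group ((semidirect H B act)\<lparr>carrier := M \<times> carrier H\<rparr>)"
    using coprime_module.group_semidirect[OF assms(1)] by simp
qed (use assms(2) in auto)

lemma span_submodule:
  assumes S: "S \<subseteq> B" and inv: "\<And>h s. h \<in> carrier H \<Longrightarrow> s \<in> S \<Longrightarrow> act h s \<in> S"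
  shows "coprime_module H p (power_span S) act" "power_span S \<subseteq> B"
proof -
  show sub: "power_span S \<subseteq> B"
    by (rule power_span_least) (use S in \<open>auto intro: one_closed_B mult_closed_B\<close>)
  show "coprime_module H p (power_span S) act"
  proof (rule submodule[OF sub one_in_power_span mult_in_power_span])
    fix h x assume h: "h \<in> carrier H" and "x \<in> power_span S"
    then obtain e where e: "x = (\<Prod>s\<in>S. s ^ e s)" by (auto simp: power_span_def)
    have "act h x = (\<Prod>s\<in>S. act h s ^ e s)"
      unfolding e using S
      by (subst act_prod[OF h]) (auto intro!: prod.cong power_closed_B simp: act_power[OF h] subset_iff)
    also have "\<dots> \<in> power_span S"
      using inv[OF h] finite_subset[OF S finite_module]
      by (auto intro!: prod_closed power_closed simp: one_in_power_span mult_in_power_span power_span_superset)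
    finally show "act h x \<in> power_span S" .
  qed
qed

text \<open>
  In the semidirect product, conjugation by \<open>u\<close> changes the component \<open>b\<close> of \<open>(b, h)\<close> by a
  coboundary, and \<open>B\<close> is the direct product of the coboundaries and the fixed points of \<open>h\<close>. The
  representative is the average of \<open>b\<close> over the powers of \<open>h\<close>.
\<close>

lemma conjugate_to_fixed:
  assumes h: "h \<in> carrier H" and b: "b \<in> B"
  obtains u m where "u \<in> B" "m \<in> B" "act h m = m"
    "inv\<^bsub>semidirect H B act\<^esub> (u, \<one>) \<otimes>\<^bsub>semidirect H B act\<^esub> (b, h) \<otimes>\<^bsub>semidirect H B act\<^esub> (u, \<one>) = (m, h)"
proof -
  obtain r where r: "\<And>x. x \<in> B \<Longrightarrow> (x ^ card (carrier H)) ^ r = x"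
    using inverse_of_group_order by blast
  define n where "n = card (carrier H)"
  define c where "c i = act (h [^] i) b" for i :: nat
  have cB: "c i \<in> B" for i using h b by (simp add: c_def act_closed)
  have c0: "c 0 = b" "c n = b"
    using h b pow_order_eq_1[OF h] by (simp_all add: c_def n_def act_id order_def)
  have c_Suc: "act h (c i) = c (Suc i)" for i
    using h b nat_pow_Suc2[OF h, of i] by (simp add: c_def act_act)
  define v where "v j = (\<Prod>i<j. c i)" for j
  have vB: "v j \<in> B" for j unfolding v_def by (intro prod_closed_B cB)
  \<comment> \<open>the product of these identities over \<open>j\<close> exhibits the quotient of \<open>b\<close> by its average as a coboundary\<close>
  have tele: "act h (v j) * b = v j * c j" for j
  proof -
    have "act h (v j) * b = (\<Prod>i<j. c (Suc i)) * c 0"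
      unfolding v_def by (subst act_prod[OF h]) (auto simp: cB c_Suc c0)
    also have "\<dots> = (\<Prod>i<Suc j. c i)"
      by (subst prod.lessThan_Suc_shift) (simp add: mult.commute)
    finally show ?thesis by (simp add: v_def)
  qed
  define u where "u = (\<Prod>j<n. v j) ^ r"
  define m where "m = (\<Prod>j<n. c j) ^ r"
  have uB: "u \<in> B" and mB: "m \<in> B"
    unfolding u_def m_def by (intro power_closed_B prod_closed_B cB vB)+
  have m_fixed: "act h m = m"
  proof -
    have "act h (\<Prod>j<n. c j) = (\<Prod>j<n. c (Suc j))"
      by (subst act_prod[OF h]) (auto simp: cB c_Suc)
    also have "\<dots> * c 0 = (\<Prod>j<n. c j) * c n"
      using prod.lessThan_Suc_shift[of c n] by (simp add: mult.commute)
    finally have "act h (\<Prod>j<n. c j) * b * minv b = (\<Prod>j<n. c j) * b * minv b"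
      by (simp add: c0)
    then show ?thesis
      using b by (simp add: m_def act_power[OF h] prod_closed_B cB mult.assoc minv_right)
  qed
  have "act h u * b = (\<Prod>j<n. act h (v j) * b) ^ r"
  proof -
    have "act h u = (\<Prod>j<n. act h (v j)) ^ r"
      unfolding u_def by (simp add: act_power[OF h] act_prod[OF h] prod_closed_B vB)
    moreover have "b = (\<Prod>j<n. b) ^ r"
      using r[OF b] by (simp add: n_def)
    ultimately show ?thesis
      by (simp add: prod.distrib power_mult_distrib)
  qed
  also have "\<dots> = u * m"
    by (simp add: tele prod.distrib power_mult_distrib u_def m_def)
  finally have key: "act h u * b = u * m" .
  have "minv u * (act \<one> b) * act h u = minv u * (act h u * b)"
    using b by (simp add: act_id ac_simps)
  also have "\<dots> = m"
    unfolding key using minv_left[OF uB] by (simp add: mult.assoc[symmetric])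
  finally have "inv\<^bsub>semidirect H B act\<^esub> (u, \<one>) \<otimes>\<^bsub>semidirect H B act\<^esub> (b, h)
      \<otimes>\<^bsub>semidirect H B act\<^esub> (u, \<one>) = (m, h)"
    using h by (simp add: inv_module_element[OF uB])
  with uB mB m_fixed show ?thesis by (rule that)
qed

end


section \<open>Invariable generation by a family of \<open>k\<close> elements\<close>

definition invariable_generators :: "('a, 'm) monoid_scheme \<Rightarrow> nat \<Rightarrow> (nat \<Rightarrow> 'a) \<Rightarrow> bool" where
  "invariable_generators G k g \<longleftrightarrow>
     g \<in> {..<k} \<rightarrow> carrier G \<and>
     (\<forall>c \<in> {..<k} \<rightarrow> carrier G.
        generate G ((\<lambda>i. inv\<^bsub>G\<^esub> c i \<otimes>\<^bsub>G\<^esub> g i \<otimes>\<^bsub>G\<^esub> c i) ` {..<k}) = carrier G)"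

lemma invariable_generators_image:
  assumes "group_hom G K f" "f ` carrier G = carrier K" "invariable_generators G k g"
  shows "invariable_generators K k (f \<circ> g)"
  unfolding invariable_generators_def
proof (intro conjI ballI)
  interpret f: group_hom G K f by fact
  have g: "g i \<in> carrier G" if "i < k" for i
    using assms(3) that by (auto simp: invariable_generators_def)
  show "f \<circ> g \<in> {..<k} \<rightarrow> carrier K" using g by auto
  fix c assume c: "c \<in> {..<k} \<rightarrow> carrier K"
  define c' where "c' i = inv_into (carrier G) f (c i)" for i
  have c': "c' i \<in> carrier G \<and> f (c' i) = c i" if "i < k" for i
  proof -
    have "c i \<in> f ` carrier G" using c assms(2) that by auto
    then show ?thesis unfolding c'_def by (simp add: inv_into_into f_inv_into_f)
  qed
  let ?X = "(\<lambda>i. inv\<^bsub>G\<^esub> c' i \<otimes>\<^bsub>G\<^esub> g i \<otimes>\<^bsub>G\<^esub> c' i) ` {..<k}"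
  have "(\<lambda>i. inv\<^bsub>K\<^esub> c i \<otimes>\<^bsub>K\<^esub> (f \<circ> g) i \<otimes>\<^bsub>K\<^esub> c i) ` {..<k} = f ` ?X"
    unfolding image_image using c' g by (intro image_cong) auto
  moreover have "generate G ?X = carrier G"
    using assms(3) c' by (auto simp: invariable_generators_def Pi_iff)
  moreover have "?X \<subseteq> carrier G" using c' g by auto
  ultimately show "generate K ((\<lambda>i. inv\<^bsub>K\<^esub> c i \<otimes>\<^bsub>K\<^esub> (f \<circ> g) i \<otimes>\<^bsub>K\<^esub> c i) ` {..<k}) = carrier K"
    using assms(2) by (simp add: f.generate_img)
qed

lemma (in group) conjugate_power:
  assumes "u \<in> carrier G" "x \<in> carrier G"
  shows "(inv u \<otimes> x \<otimes> u) [^] (n::nat) = inv u \<otimes> x [^] n \<otimes> u"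
proof (induction n)
  case 0
  show ?case using assms by simp
next
  case (Suc n)
  have cancel: "y \<otimes> (inv y \<otimes> z) = z" if "y \<in> carrier G" "z \<in> carrier G" for y z
    using that by (simp add: m_assoc[symmetric])
  have "(inv u \<otimes> x \<otimes> u) [^] Suc n = (inv u \<otimes> x [^] n \<otimes> u) \<otimes> (inv u \<otimes> x \<otimes> u)"
    by (simp only: nat_pow_Suc Suc)
  also have "\<dots> = inv u \<otimes> x [^] Suc n \<otimes> u"
    using assms by (simp add: m_assoc cancel)
  finally show ?case .
qed

context coprime_module
begin

text \<open>
  The stabiliser of \<open>m\<close> contains \<open>\<one>, h, \<dots>, h ^ k\<close>, so each fibre of the orbit map has at least
  \<open>k + 1\<close> elements.
\<close>

lemma orbit_of_fixed_point_card:
  assumes h: "h \<in> carrier H" and m: "m \<in> B" "act h m = m"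
    and ord: "\<And>j. 1 \<le> j \<Longrightarrow> j \<le> k \<Longrightarrow> h [^] (j::nat) \<noteq> \<one>"
  shows "card ((\<lambda>x. act x m) ` carrier H) * (k + 1) \<le> card (carrier H)"
proof -
  let ?f = "\<lambda>x. act x m"
  have pow_fixed: "act (h [^] j) m = m" for j :: nat
  proof (induction j)
    case 0
    then show ?case using m by (simp add: act_id)
  next
    case (Suc j)
    then show ?case using h m by (simp add: act_act[symmetric])
  qed
  have inj: "inj_on (\<lambda>j. h [^] (j::nat)) {..k}"
  proof (rule inj_onI)
    have *: False if "h [^] i = h [^] j" "i < j" "j \<le> k" for i j :: nat
    proof -
      have "h [^] (j - i) = \<one>"
        using pow_eq_div2[OF h, of j i] that by simp
      then show False using ord[of "j - i"] that by auto
    qed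
    fix i j assume "i \<in> {..k}" "j \<in> {..k}" "h [^] i = h [^] j"
    then show "i = j" using *[of i j] *[of j i] by (cases i j rule: linorder_cases) auto
  qed
  have fibre: "k + 1 \<le> card {x \<in> carrier H. ?f x = y}" if y: "y \<in> ?f ` carrier H" for y
  proof -
    obtain x where x: "x \<in> carrier H" "y = act x m" using y by auto
    have "k + 1 = card ((\<lambda>j. x \<otimes> h [^] (j::nat)) ` {..k})"
    proof (subst card_image)
      show "inj_on (\<lambda>j. x \<otimes> h [^] (j::nat)) {..k}"
        using inj h x by (auto simp: inj_on_def)
    qed simp
    also have "\<dots> \<le> card {x \<in> carrier H. ?f x = y}"
      using finite_group h x m
      by (intro card_mono) (auto simp: act_act[symmetric] pow_fixed)
    finally show ?thesis .
  qed
  have "card (?f ` carrier H) * (k + 1) = (\<Sum>y\<in>?f ` carrier H. k + 1)"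
    by simp
  also have "\<dots> \<le> (\<Sum>y\<in>?f ` carrier H. card {x \<in> carrier H. ?f x = y})"
    by (intro sum_mono fibre)
  also have "\<dots> = card (carrier H)"
    using sum.image_gen[OF finite_group, of "\<lambda>_. 1 :: nat" ?f]
    by (simp only: card_eq_sum)
  finally show ?thesis .
qed

text \<open>
  Conjugate every \<open>g i\<close> so that its module component \<open>m i\<close> is fixed by \<open>h i = snd (g i)\<close>. If
  \<open>g i ^ N = 1\<close> then \<open>m i\<close> has order dividing both \<open>N\<close> and \<open>p\<close>, hence is trivial. Otherwise \<open>h i\<close>
  has order larger than \<open>k\<close>, so the orbit of \<open>m i\<close> has at most \<open>card (carrier H) / (k + 1)\<close>
  elements. The \<open>k\<close> orbits together are too small to span \<open>B\<close>, and the conjugates lie in the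
  semidirect product of \<open>H\<close> with the span.
\<close>

lemma not_invariable_generators_semidirect:
  assumes large: "p ^ card (carrier H) \<le> card B" and N: "coprime p N"
    and g: "g \<in> {..<k} \<rightarrow> carrier (semidirect H B act)"
    and long: "\<And>i. \<lbrakk>i < k; g i [^]\<^bsub>semidirect H B act\<^esub> N \<noteq> \<one>\<^bsub>semidirect H B act\<^esub>\<rbrakk> \<Longrightarrow>
                 snd (g i) [^] (N * fact k) \<noteq> \<one>"
  shows "\<not> invariable_generators (semidirect H B act) k g"
proof
  let ?W = "semidirect H B act"
  assume inv_gen: "invariable_generators ?W k g"
  have gi: "fst (g i) \<in> B" "snd (g i) \<in> carrier H" if "i < k" for i
    using g that by (auto simp: Pi_iff mem_Times_iff)
  have "\<forall>i. \<exists>u m. i < k \<longrightarrow> u \<in> B \<and> m \<in> B \<and> act (snd (g i)) m = m \<and>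
      inv\<^bsub>?W\<^esub> (u, \<one>) \<otimes>\<^bsub>?W\<^esub> g i \<otimes>\<^bsub>?W\<^esub> (u, \<one>) = (m, snd (g i))"
    using conjugate_to_fixed gi by (metis prod.collapse)
  then obtain u m where um: "\<And>i. i < k \<Longrightarrow> u i \<in> B \<and> m i \<in> B \<and> act (snd (g i)) (m i) = m i \<and>
      inv\<^bsub>?W\<^esub> (u i, \<one>) \<otimes>\<^bsub>?W\<^esub> g i \<otimes>\<^bsub>?W\<^esub> (u i, \<one>) = (m i, snd (g i))"
    by metis
  have trivial: "m i = 1" if "i < k" and gN: "g i [^]\<^bsub>?W\<^esub> N = \<one>\<^bsub>?W\<^esub>" for i
  proof -
    have mB: "m i \<in> B" and fixed: "act (snd (g i)) (m i) = m i" using um[OF that(1)] by auto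
    have fixed_pow: "act (snd (g i) [^] n) (m i) = m i" for n :: nat
    proof (induction n)
      case 0
      then show ?case using mB by (simp add: act_id)
    next
      case (Suc n)
      then show ?case using mB gi[OF that(1)] by (simp add: act_act[symmetric] fixed)
    qed
    have pow: "(m i, snd (g i)) [^]\<^bsub>?W\<^esub> n = (m i ^ n, snd (g i) [^] n)" for n :: nat
    proof (induction n)
      case (Suc n)
      have "(m i, snd (g i)) [^]\<^bsub>?W\<^esub> Suc n = (m i, snd (g i)) [^]\<^bsub>?W\<^esub> n \<otimes>\<^bsub>?W\<^esub> (m i, snd (g i))"
        by (rule SD.nat_pow_Suc)
      then show ?case
        unfolding Suc by (simp add: fixed_pow mult.commute)
    qed simp
    have "(m i, snd (g i)) [^]\<^bsub>?W\<^esub> N = inv\<^bsub>?W\<^esub> (u i, \<one>) \<otimes>\<^bsub>?W\<^esub> g i [^]\<^bsub>?W\<^esub> N \<otimes>\<^bsub>?W\<^esub> (u i, \<one>)"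
      using um[OF that(1)] g that(1) SD.conjugate_power[of "(u i, \<one>)" "g i" N] by auto
    also have "\<dots> = \<one>\<^bsub>?W\<^esub>"
      unfolding gN using um[OF that(1)] SD.r_one SD.l_inv[of "(u i, \<one>)"]
        SD.inv_closed[of "(u i, \<one>)"] by simp
    finally have mN: "m i ^ N = 1" by (simp add: pow)
    obtain r where "[N * r = 1] (mod p)"
      using N cong_solve_coprime_nat[of N p] by (auto simp: coprime_commute)
    then have "(m i ^ N) ^ r = m i"
      using power_cong[OF mB, of "N * r" 1] by (simp add: power_mult)
    then show ?thesis by (simp add: mN)
  qed
  define L where "L = {i. i < k \<and> g i [^]\<^bsub>?W\<^esub> N \<noteq> \<one>\<^bsub>?W\<^esub>}"
  define S where "S = (\<Union>i\<in>L. (\<lambda>x. act x (m i)) ` carrier H)"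
  have L: "L \<subseteq> {..<k}" "finite L" by (auto simp: L_def)
  have orbit: "card ((\<lambda>x. act x (m i)) ` carrier H) * (k + 1) \<le> card (carrier H)" if "i \<in> L" for i
  proof (rule orbit_of_fixed_point_card[where h = "snd (g i)"])
    fix j :: nat assume j: "1 \<le> j" "j \<le> k"
    show "snd (g i) [^] j \<noteq> \<one>"
    proof
      assume one: "snd (g i) [^] j = \<one>"
      obtain q where "N * fact k = j * q"
        using j dvd_fact[of j k] by (metis dvd_def dvd_mult)
      then have "snd (g i) [^] (N * fact k) = (snd (g i) [^] j) [^] q"
        using gi(2)[of i] that L nat_pow_pow[of "snd (g i)" j q] by auto
      then show False using long[of i] that one by (simp add: L_def)
    qed
  qed (use um gi that L in auto)
  have SB: "S \<subseteq> B" using um L by (auto simp: S_def intro!: act_closed)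
  have "act h s \<in> S" if "h \<in> carrier H" "s \<in> S" for h s
  proof -
    obtain i x where i: "i \<in> L" "x \<in> carrier H" "s = act x (m i)"
      using \<open>s \<in> S\<close> by (auto simp: S_def)
    then have "act h s = act (h \<otimes> x) (m i)"
      using um[of i] L \<open>h \<in> carrier H\<close> by (auto simp: act_act)
    then show ?thesis using i \<open>h \<in> carrier H\<close> by (auto simp: S_def)
  qed
  note span = span_submodule[OF SB this]
  have "B = power_span S"
  proof -
    let ?c = "\<lambda>i. (u i, \<one>)"
    let ?X = "(\<lambda>i. inv\<^bsub>?W\<^esub> ?c i \<otimes>\<^bsub>?W\<^esub> g i \<otimes>\<^bsub>?W\<^esub> ?c i) ` {..<k}"
    have "?c \<in> {..<k} \<rightarrow> carrier ?W" using um by auto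
    then have gen: "generate ?W ?X = carrier ?W"
      using inv_gen by (auto simp: invariable_generators_def)
    have "m i \<in> power_span S" if "i < k" for i
    proof (cases "i \<in> L")
      case True
      then have "m i \<in> S"
        using um that by (auto simp: S_def act_id intro!: bexI[of _ i] image_eqI[of _ _ \<one>])
      then show ?thesis using SB finite_module finite_subset by (blast intro: power_span_superset)
    next
      case False
      then show ?thesis using trivial[OF that] that by (auto simp: L_def one_in_power_span)
    qed
    then have "?X \<subseteq> power_span S \<times> carrier H"
      using um gi by (auto simp del: semidirect_simps)
    then have "generate ?W ?X \<subseteq> power_span S \<times> carrier H"
      using SD.generate_subgroup_incl subgroup_semidirect[OF span] by blast
    then have "B \<times> carrier H \<subseteq> power_span S \<times> carrier H" unfolding gen by simp
    then show ?thesis using span(2) one_closed by blast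
  qed
  have "card B \<le> p ^ card S"
    unfolding \<open>B = power_span S\<close>[symmetric]
    using power_span_card(2)[of S p] SB finite_module finite_subset p_pos power_p \<open>B = power_span S\<close>
    by (metis subsetD)
  then have "card (carrier H) \<le> card S"
    using large prime_p prime_gt_1_nat[of p] power_le_imp_le_exp le_trans by metis
  moreover have "card S * (k + 1) \<le> k * card (carrier H)"
  proof -
    have "card S \<le> (\<Sum>i\<in>L. card ((\<lambda>x. act x (m i)) ` carrier H))"
      unfolding S_def by (rule card_UN_le[OF L(2)])
    then have "card S * (k + 1) \<le> (\<Sum>i\<in>L. card ((\<lambda>x. act x (m i)) ` carrier H)) * (k + 1)"
      by (rule mult_right_mono) simp
    also have "\<dots> \<le> (\<Sum>i\<in>L. card (carrier H))"
      unfolding sum_distrib_right by (intro sum_mono orbit)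
    also have "\<dots> \<le> k * card (carrier H)"
      using card_mono[OF _ L(1)] by simp
    finally show ?thesis .
  qed
  moreover have "card (carrier H) > 0"
    using finite_group one_closed by (auto simp: card_gt_0_iff)
  ultimately show False
    using mult_right_mono[of "card (carrier H)" "card S" "k + 1"] by (simp add: algebra_simps)
qed

end


section \<open>Complements\<close>

context coprime_module
begin

lemma minv_minv: "x \<in> B \<Longrightarrow> minv (minv x) = x"
  using minv_left[of x] minv_left[of "minv x"] minv_closed[of x]
  by (metis mult.assoc mult.left_neutral mult.right_neutral)

text \<open>
  A subgroup \<open>G\<close> that projects onto \<open>H\<close> and meets \<open>B\<close> in \<open>M\<close> is the graph of a crossed homomorphism
  from \<open>H\<close> to \<open>B\<close> modulo \<open>M\<close>. As \<open>p\<close> does not divide the order of \<open>H\<close>, averaging its values shows that it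
  is principal, given by some \<open>a\<close>; that is, conjugation by \<open>a\<close> turns \<open>G\<close> into the semidirect
  product of \<open>M\<close> and \<open>H\<close>.
\<close>

lemma subgroup_complement:
  assumes G: "subgroup G (semidirect H B act)" and onto: "snd ` G = carrier H"
    and M_def: "M = {b. (b, \<one>) \<in> G}"
  obtains a where "a \<in> B" "coprime_module H p M act" "M \<subseteq> B"
    "\<And>b h. \<lbrakk>b \<in> B; h \<in> carrier H\<rbrakk> \<Longrightarrow> (b, h) \<in> G \<longleftrightarrow> b * act h a * minv a \<in> M"
proof -
  let ?W = "semidirect H B act"
  interpret G: subgroup G ?W by fact
  have mult_G: "(b * act h c, h \<otimes> k) \<in> G" if "(b, h) \<in> G" "(c, k) \<in> G" for b h c k
    using G.m_closed[OF that] by simp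
  have sub: "M \<subseteq> B" using G.subset by (auto simp: M_def)
  have one: "1 \<in> M" using G.one_closed by (simp add: M_def)
  have mult: "x * y \<in> M" if "x \<in> M" "y \<in> M" for x y
    using mult_G[of x \<one> y \<one>] that sub by (auto simp: M_def act_id)
  note M_pow = power_closed[OF one mult]
  have M_minv: "minv x \<in> M" if "x \<in> M" for x
    unfolding minv_def by (rule M_pow[OF _ _ that])
  have inv_G: "(act (inv h) (minv b), inv h) \<in> G" if "(b, h) \<in> G" for b h
  proof -
    have c: "b \<in> B" "h \<in> carrier H" using that G.subset by auto
    have "inv\<^bsub>?W\<^esub> (b, h) = (act (inv h) (minv b), inv h)"
      using c by (intro SD.inv_equality)
        (auto simp: act_closed minv_closed minv_left act_one act_mult[symmetric])
    then show ?thesis using G.m_inv_closed[OF that] by simp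
  qed
  have "\<forall>h\<in>carrier H. \<exists>b. (b, h) \<in> G" using onto by (metis imageE prod.collapse)
  from bchoice[OF this] obtain f where f: "\<And>h. h \<in> carrier H \<Longrightarrow> (f h, h) \<in> G" by blast
  have fB: "f h \<in> B" if "h \<in> carrier H" for h using f[OF that] G.subset by auto
  have diff: "b * minv c \<in> M" if "(b, h) \<in> G" "(c, h) \<in> G" for b c h
  proof -
    have c: "b \<in> B" "c \<in> B" "h \<in> carrier H" using that G.subset by auto
    show ?thesis
      using mult_G[OF that(1) inv_G[OF that(2)]] c by (simp add: act_act act_id minv_closed M_def)
  qed
  have shift: "(m * c, h) \<in> G" if "m \<in> M" "(c, h) \<in> G" for m c h
  proof -
    have "c \<in> B" "h \<in> carrier H" using that G.subset by auto
    then show ?thesis using mult_G[of m \<one> c h] that by (simp add: M_def act_id)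
  qed
  have M_act: "act h x \<in> M" if h: "h \<in> carrier H" and x: "x \<in> M" for h x
  proof -
    have xB: "x \<in> B" using x sub by auto
    have "(f h * act h x, h) \<in> G"
      using mult_G[OF f[OF h], of x \<one>] x h by (simp add: M_def)
    from diff[OF this f[OF h]] show ?thesis
      using minv_right[OF fB[OF h]] by (simp add: mult.commute[of "f h"] mult.assoc)
  qed
  have M: "coprime_module H p M act"
    by (rule submodule[OF sub one mult M_act])
  obtain r where r: "\<And>x. x \<in> B \<Longrightarrow> (x ^ card (carrier H)) ^ r = x"
    using inverse_of_group_order by blast
  define A where "A = (\<Prod>k\<in>carrier H. f k)"
  define a where "a = A ^ r"
  have AB: "A \<in> B" and aB: "a \<in> B"
    unfolding A_def a_def by (auto intro!: power_closed_B prod_closed_B fB)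
  \<comment> \<open>multiply the cocycle condition over all \<open>k\<close>, then divide by the group order\<close>
  have cocycle: "f h * act h a * minv a \<in> M" if h: "h \<in> carrier H" for h
  proof -
    have step: "f h * act h (f k) * minv (f (h \<otimes> k)) \<in> M" if "k \<in> carrier H" for k
      using diff[OF mult_G[OF f[OF h] f[OF that]] f] h that by simp
    have "(\<Prod>k\<in>carrier H. f h * act h (f k) * minv (f (h \<otimes> k))) \<in> M"
      by (rule prod_closed[OF one mult]) (use step in auto)
    moreover have "(\<Prod>k\<in>carrier H. f h * act h (f k) * minv (f (h \<otimes> k)))
        = f h ^ card (carrier H) * act h A * minv (\<Prod>k\<in>carrier H. f (h \<otimes> k))"
      by (simp add: prod.distrib act_prod[OF h] fB A_def minv_def power_of_prod)
    moreover have "(\<Prod>k\<in>carrier H. f (h \<otimes> k)) = A"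
      unfolding A_def
      by (rule prod.reindex_bij_witness[where i = "\<lambda>k. inv h \<otimes> k" and j = "\<lambda>k. h \<otimes> k"])
        (use h in \<open>auto simp: m_assoc[symmetric]\<close>)
    ultimately have "f h ^ card (carrier H) * act h A * minv A \<in> M" by simp
    then have "(f h ^ card (carrier H) * act h A * minv A) ^ r \<in> M"
      by (intro M_pow)
    also have "(f h ^ card (carrier H) * act h A * minv A) ^ r = f h * act h a * minv a"
      using r[OF fB[OF h]] h AB
      by (simp add: power_mult_distrib a_def act_power minv_def power_mult[symmetric] mult.commute)
    finally show ?thesis .
  qed
  show ?thesis
  proof (rule that[OF aB M sub])
    fix b h assume b: "b \<in> B" and h: "h \<in> carrier H"
    have can: "minv (f h) * f h = 1" "f h * minv (f h) = 1"
      using fB[OF h] by (auto simp: minv_left minv_right)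
    let ?z = "f h * act h a * minv a"
    have zB: "?z \<in> B" using cocycle[OF h] sub by auto
    have zc: "?z * minv ?z = 1" by (rule minv_right[OF zB])
    have "b * act h a * minv a = (b * minv (f h)) * ?z"
      using can by (metis (no_types, lifting) mult.assoc mult.right_neutral)
    moreover have "b * minv (f h) = (b * act h a * minv a) * minv ?z"
      unfolding calculation using zc by (simp only: mult.assoc mult.right_neutral)
    moreover have "(b, h) \<in> G \<longleftrightarrow> b * minv (f h) \<in> M"
    proof
      show "b * minv (f h) \<in> M" if "(b, h) \<in> G" using diff[OF that f[OF h]] .
      show "(b, h) \<in> G" if "b * minv (f h) \<in> M"
        using shift[OF that f[OF h]] can by (simp add: mult.assoc)
    qed
    ultimately show "(b, h) \<in> G \<longleftrightarrow> b * act h a * minv a \<in> M"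
      using mult cocycle[OF h] M_minv[OF cocycle[OF h]] by metis
  qed
qed

text \<open>
  If every element of \<open>E\<close> is congruent modulo \<open>M\<close> to a value of the principal crossed homomorphism
  given by \<open>a\<close>, then \<open>B\<close> is generated modulo \<open>M\<close> by the orbit of \<open>a\<close>.
\<close>

lemma card_module_le:
  assumes M: "coprime_module H p M act" "M \<subseteq> B" and a: "a \<in> B" and E: "E \<subseteq> B"
    and gen: "\<And>e. e \<in> E \<Longrightarrow> \<exists>h\<in>carrier H. e * act h a * minv a \<in> M"
    and span: "B \<subseteq> power_span (\<Union>h\<in>carrier H. act h ` E)"
  shows "card B \<le> card M * p ^ card (carrier H)"
proof -
  interpret M: coprime_module H p M act by fact
  define Q where "Q = (\<lambda>h. act h (minv a)) ` carrier H"
  have QB: "Q \<subseteq> B" using a by (auto simp: Q_def act_closed minv_closed)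
  have "act h x \<in> Q" if "h \<in> carrier H" "x \<in> Q" for h x
    using that a by (auto simp: Q_def act_act minv_closed)
  note Q = span_submodule[OF QB this]
  interpret S: coprime_module H p "power_span Q" act by (rule Q(1))
  have finQ: "finite Q" using finite_group by (simp add: Q_def)
  define T where "T = (\<lambda>(m, s). m * s) ` (M \<times> power_span Q)"
  have T1: "1 \<in> T"
    unfolding T_def using M.one_closed_B one_in_power_span by (intro image_eqI[of _ _ "(1, 1)"]) auto
  have Tmult: "x * y \<in> T" if xy: "x \<in> T" "y \<in> T" for x y
  proof -
    obtain m s n t where *: "x = m * s" "y = n * t" "m \<in> M" "n \<in> M" "s \<in> power_span Q" "t \<in> power_span Q"
      using xy by (auto simp: T_def)
    then have "x * y = (m * n) * (s * t)" by (simp add: ac_simps)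
    with * show ?thesis
      unfolding T_def by (intro image_eqI[of _ _ "(m * n, s * t)"]) (auto intro: M.mult_closed_B mult_in_power_span)
  qed
  have Tact: "act h x \<in> T" if hx: "h \<in> carrier H" "x \<in> T" for h x
  proof -
    obtain m s where *: "x = m * s" "m \<in> M" "s \<in> power_span Q" using hx by (auto simp: T_def)
    then have "act h x = act h m * act h s" using hx(1) M(2) Q(2) by (simp add: act_mult subset_iff)
    with * hx show ?thesis
      unfolding T_def by (intro image_eqI[of _ _ "(act h m, act h s)"]) (auto intro: M.act_closed S.act_closed)
  qed
  have ET: "e \<in> T" if e: "e \<in> E" for e
  proof -
    obtain h where h: "h \<in> carrier H" and m: "e * act h a * minv a \<in> M" using gen[OF e] by auto
    have mem: "minv a \<in> power_span Q" "act h (minv a) \<in> power_span Q"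
    proof -
      have "act k (minv a) \<in> power_span Q" if "k \<in> carrier H" for k
        using that finQ by (intro power_span_superset) (auto simp: Q_def)
      from this[OF h] this[OF one_closed] show "minv a \<in> power_span Q" "act h (minv a) \<in> power_span Q"
        using a by (simp_all add: act_id minv_closed)
    qed
    have "a \<in> power_span Q"
      using S.power_closed_B[OF mem(1), of "p - 1"] minv_minv[OF a] by (simp add: minv_def)
    then have s: "a * act h (minv a) \<in> power_span Q" using mem by (intro mult_in_power_span)
    have "act h a * act h (minv a) = 1"
      using h a by (simp add: act_mult[symmetric] minv_closed minv_right act_one)
    moreover have "(e * act h a * minv a) * (a * act h (minv a))
        = e * (act h a * act h (minv a)) * (minv a * a)"
      by (simp only: ac_simps)
    ultimately have "e = (e * act h a * minv a) * (a * act h (minv a))"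
      using a by (simp add: minv_left)
    then show ?thesis
      unfolding T_def using m s by (intro image_eqI[of _ _ "(e * act h a * minv a, a * act h (minv a))"]) auto
  qed
  have "power_span (\<Union>h\<in>carrier H. act h ` E) \<subseteq> T"
    using ET Tact by (intro power_span_least T1 Tmult) auto
  then have "B \<subseteq> T" using span by auto
  have finT: "finite T" unfolding T_def using M.finite_module S.finite_module by auto
  have "card B \<le> card T" by (rule card_mono[OF finT \<open>B \<subseteq> T\<close>])
  also have "\<dots> \<le> card (M \<times> power_span Q)"
    unfolding T_def using M.finite_module S.finite_module by (intro card_image_le) auto
  also have "\<dots> \<le> card M * p ^ card Q"
    using power_span_card(2)[OF finQ p_pos] QB power_p
    by (auto simp: card_cartesian_product subset_iff)
  also have "\<dots> \<le> card M * p ^ card (carrier H)"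
    using card_image_le[OF finite_group, of "\<lambda>h. act h (minv a)"] p_pos
    by (intro mult_left_mono power_increasing) (auto simp: Q_def)
  finally show ?thesis .
qed

end


section \<open>The free module of rank two\<close>

text \<open>
  The group of \<open>p\<close>-th roots of unity serves as the additive group of \<open>\<F>\<^sub>p\<close>. The functions are
  trivial outside the carrier, so that there are finitely many of them.
\<close>

definition free_module :: "('a, 'm) monoid_scheme \<Rightarrow> nat \<Rightarrow> ('a \<times> bool \<Rightarrow> complex) set" where
  "free_module H p = {f. \<forall>x. f x ^ p = 1 \<and> (fst x \<notin> carrier H \<longrightarrow> f x = 1)}"

definition translate ::
    "('a, 'm) monoid_scheme \<Rightarrow> 'a \<Rightarrow> ('a \<times> bool \<Rightarrow> complex) \<Rightarrow> 'a \<times> bool \<Rightarrow> complex" where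
  "translate H h f = (\<lambda>(x, i). if x \<in> carrier H then f (inv\<^bsub>H\<^esub> h \<otimes>\<^bsub>H\<^esub> x, i) else 1)"

definition basis_element :: "nat \<Rightarrow> 'a \<times> bool \<Rightarrow> 'a \<times> bool \<Rightarrow> complex" where
  "basis_element p s = (\<lambda>x. if x = s then cis (2 * pi / real p) else 1)"

lemma power_fun_apply: "(f ^ n) x = (f x :: complex) ^ n"
  by (induction n) auto

lemma prod_fun_apply: "(\<Prod>i\<in>I. f i) x = (\<Prod>i\<in>I. f i x :: complex)"
  by (induction I rule: infinite_finite_induct) auto

lemma free_module_card:
  assumes fin: "finite (carrier H)" and p: "p > 0"
  shows "finite (free_module H p)" "card (free_module H p) = p ^ (2 * card (carrier H))"
proof -
  let ?S = "carrier H \<times> (UNIV :: bool set)"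
  let ?R = "{z :: complex. z ^ p = 1}"
  have "bij_betw (\<lambda>f. restrict f ?S) (free_module H p) (?S \<rightarrow>\<^sub>E ?R)"
  proof (rule bij_betw_byWitness[where f' = "\<lambda>f x. if x \<in> ?S then f x else 1"])
    show "\<forall>f\<in>free_module H p. (\<lambda>x. if x \<in> ?S then restrict f ?S x else 1) = f"
      by (auto simp: free_module_def fun_eq_iff)
    show "\<forall>f\<in>?S \<rightarrow>\<^sub>E ?R. restrict (\<lambda>x. if x \<in> ?S then f x else 1) ?S = f"
    proof
      fix f assume "f \<in> ?S \<rightarrow>\<^sub>E ?R"
      then have f: "restrict f ?S = f" by (rule PiE_restrict)
      have "restrict (\<lambda>x. if x \<in> ?S then f x else 1) ?S = restrict f ?S"
        by (rule restrict_ext) simp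
      then show "restrict (\<lambda>x. if x \<in> ?S then f x else 1) ?S = f"
        unfolding f .
    qed
    show "(\<lambda>f. restrict f ?S) ` free_module H p \<subseteq> ?S \<rightarrow>\<^sub>E ?R"
    proof (rule image_subsetI)
      fix f assume "f \<in> free_module H p"
      then have "f x ^ p = 1" for x unfolding free_module_def by blast
      then show "restrict f ?S \<in> ?S \<rightarrow>\<^sub>E ?R" by simp
    qed
    show "(\<lambda>f x. if x \<in> ?S then f x else 1) ` (?S \<rightarrow>\<^sub>E ?R) \<subseteq> free_module H p"
    proof (rule image_subsetI)
      fix f assume "f \<in> ?S \<rightarrow>\<^sub>E ?R"
      then have "f x ^ p = 1" if "x \<in> ?S" for x using PiE_mem[OF _ that] by blast
      then show "(\<lambda>x. if x \<in> ?S then f x else 1) \<in> free_module H p"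
        by (simp add: free_module_def mem_Times_iff)
    qed
  qed
  moreover have "finite ?R" using p by (intro finite_roots_unity) auto
  then have "finite (?S \<rightarrow>\<^sub>E ?R)" using fin by (intro finite_PiE) auto
  moreover have "card (?S \<rightarrow>\<^sub>E ?R) = p ^ (2 * card (carrier H))"
    using fin p card_roots_unity_eq[of p] by (simp add: card_PiE card_cartesian_product mult.commute)
  ultimately show "finite (free_module H p)" "card (free_module H p) = p ^ (2 * card (carrier H))"
    using bij_betw_finite bij_betw_same_card by metis+
qed

lemma coprime_module_free:
  assumes "group H" "finite (carrier H)" "Factorial_Ring.prime p" "coprime p (card (carrier H))"
  shows "coprime_module H p (free_module H p) (translate H)"
proof -
  interpret H: group H by fact
  show ?thesis
  proof (intro coprime_module.intro coprime_module_axioms.intro)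
    show "finite (free_module H p)"
      using assms by (intro free_module_card) (auto simp: prime_gt_0_nat)
    show "x ^ p = 1" if "x \<in> free_module H p" for x
      using that by (auto simp: free_module_def fun_eq_iff power_fun_apply)
    show "translate H h (translate H k x) = translate H (h \<otimes>\<^bsub>H\<^esub> k) x"
      if "h \<in> carrier H" "k \<in> carrier H" for h k x
      using that by (auto simp: translate_def fun_eq_iff H.inv_mult_group H.m_assoc)
  qed (use assms in \<open>auto simp: free_module_def translate_def power_mult_distrib fun_eq_iff\<close>)
qed

lemma translate_basis_element:
  assumes "group H" "s \<in> carrier H"
  shows "translate H s (basis_element p (\<one>\<^bsub>H\<^esub>, i)) = basis_element p (s, i)"
proof -
  interpret H: group H by fact
  have "inv\<^bsub>H\<^esub> s \<otimes>\<^bsub>H\<^esub> x = \<one>\<^bsub>H\<^esub> \<longleftrightarrow> x = s" if "x \<in> carrier H" for x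
    using that assms(2) by (metis H.inv_closed H.inv_inv H.l_inv H.inv_equality)
  then show ?thesis
    using assms(2) by (auto simp: translate_def basis_element_def fun_eq_iff)
qed

lemma free_module_span:
  assumes fin: "finite (carrier H)" and p: "p > 0"
  shows "free_module H p \<subseteq> power_span (basis_element p ` (carrier H \<times> UNIV))"
proof
  let ?S = "carrier H \<times> (UNIV :: bool set)"
  have finS: "finite ?S" using fin by simp
  fix f assume f: "f \<in> free_module H p"
  have "\<exists>n. f s = cis (2 * pi / real p) ^ n" for s
  proof -
    have "f s \<in> {z. z ^ p = 1}" using f unfolding free_module_def by blast
    then obtain k where "f s = cis (2 * pi * real k / real p)"
      using bij_betw_imp_surj_on[OF Complex.bij_betw_roots_unity[OF p]] by force
    then show ?thesis by (auto simp: Complex.DeMoivre algebra_simps intro!: exI[of _ k])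
  qed
  then obtain n where n: "\<And>s. f s = cis (2 * pi / real p) ^ n s" by metis
  have "f = (\<Prod>s\<in>?S. basis_element p s ^ n s)"
  proof
    fix x
    have "(\<Prod>s\<in>?S. basis_element p s ^ n s) x = (\<Prod>s\<in>?S. if s = x then f x else 1)"
      unfolding prod_fun_apply power_fun_apply
      by (intro prod.cong) (auto simp: basis_element_def n)
    also have "\<dots> = f x"
      using f finS by (cases x) (auto simp: free_module_def)
    finally show "f x = (\<Prod>s\<in>?S. basis_element p s ^ n s) x" by simp
  qed
  also have "\<dots> \<in> power_span (basis_element p ` ?S)"
    using finS
    by (auto intro!: prod_closed power_closed
        simp: one_in_power_span mult_in_power_span power_span_superset)
  finally show "f \<in> power_span (basis_element p ` ?S)" .
qed

text \<open>
  This is a Magnus embedding. Two of the generators of \<open>H\<close> are lifted to \<open>(e\<^sub>0, h\<^sub>0)\<close> and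
  \<open>(e\<^sub>1, h\<^sub>1)\<close> in the semidirect product of \<open>H\<close> with the free module on \<open>e\<^sub>0, e\<^sub>1\<close>, the others to
  \<open>(1, h\<^sub>i)\<close>. Let \<open>G\<close> be the subgroup generated by the lifts and \<open>M\<close> its intersection with the free
  module. As \<open>G\<close> splits over \<open>M\<close>, the free module modulo \<open>M\<close> is cyclic, so of the
  \<open>2 * card (carrier H)\<close> dimensions at least half are left for \<open>M\<close>. Conjugating by the \<open>a\<close> that
  splits \<open>G\<close> makes \<open>G\<close> itself a semidirect product.
\<close>

lemma large_split_extension:
  fixes H :: "('a, 'm) monoid_scheme" and \<pi> :: "letter list \<Rightarrow> 'a"
  assumes H: "group H" "finite (carrier H)"
    and \<pi>: "\<pi> \<in> hom (free_group d) H" "\<pi> ` carrier (free_group d) = carrier H" and d: "d \<ge> 2"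
    and p: "Factorial_Ring.prime p" "coprime p (card (carrier H))"
  obtains M :: "('a \<times> bool \<Rightarrow> complex) set" and act \<phi> where
    "coprime_module H p M act" "p ^ card (carrier H) \<le> card M"
    "\<phi> \<in> hom (free_group d) (semidirect H M act)"
    "\<phi> ` carrier (free_group d) = carrier (semidirect H M act)"
proof -
  let ?F = "free_group d" and ?B = "free_module H p" and ?act = "translate H"
  let ?W = "semidirect H ?B ?act"
  interpret B: coprime_module H p ?B ?act by (rule coprime_module_free[OF H p])
  have gen_F: "[(i, True)] \<in> carrier ?F" if "i < d" for i
    using that by (simp add: free_group_def reduced_Cons)
  have basis_in: "basis_element p (\<one>\<^bsub>H\<^esub>, i) \<in> ?B" for i
    using bij_betw_apply[OF Complex.bij_betw_roots_unity[OF B.p_pos], of 1] B.p_pos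
      prime_gt_1_nat[OF p(1)] by (auto simp: free_module_def basis_element_def)
  define x where "x i = (if i = 0 then basis_element p (\<one>\<^bsub>H\<^esub>, False)
      else if i = 1 then basis_element p (\<one>\<^bsub>H\<^esub>, True) else 1, \<pi> [(i, True)])" for i :: nat
  have x: "x i \<in> carrier ?W" if "i < d" for i
    using basis_in B.one_closed_B \<pi>(1) gen_F[OF that] by (auto simp: x_def hom_def)
  obtain \<psi> where \<psi>: "\<psi> \<in> hom ?F ?W" "\<And>i. i < d \<Longrightarrow> \<psi> [(i, True)] = x i"
    using free_group_lift[OF B.group_semidirect, of d x] x by blast
  interpret \<psi>: group_hom ?F ?W \<psi>
    using group_free_group B.group_semidirect \<psi>(1) by (intro group_hom.intro group_hom_axioms.intro)
  interpret \<pi>: group_hom ?F H \<pi>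
    using group_free_group H \<pi>(1) by (intro group_hom.intro group_hom_axioms.intro)
  have over: "snd (\<psi> w) = \<pi> w" if w: "w \<in> carrier ?F" for w
  proof -
    let ?f = "restrict (snd \<circ> \<psi>) (carrier ?F)" and ?g = "restrict \<pi> (carrier ?F)"
    have "snd \<circ> \<psi> \<in> hom ?F H" using \<psi>(1) B.snd_hom by (rule hom_compose)
    then have "?f \<in> hom ?F H" "?g \<in> hom ?F H"
      using \<pi>(1) \<psi>.G.m_closed by (auto simp: hom_def Pi_iff)
    moreover have "?f [(i, True)] = \<pi> [(i, True)]" "?g [(i, True)] = \<pi> [(i, True)]" if "i < d" for i
      using that gen_F[OF that] \<psi>(2) by (simp_all add: x_def)
    moreover have "\<pi> [(i, True)] \<in> carrier H" if "i < d" for i using gen_F[OF that] by simp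
    ultimately have "?f = ?g"
      using free_group_lift[OF H(1), of d "\<lambda>i. \<pi> [(i, True)]"] restrict_extensional by metis
    then show ?thesis using w by (metis comp_apply restrict_apply')
  qed
  define G where "G = \<psi> ` carrier ?F"
  have G: "subgroup G ?W"
    unfolding G_def by (rule \<psi>.img_is_subgroup)
  have onto: "snd ` G = carrier H"
    using \<pi>(2) over by (force simp: G_def image_image)
  define M where "M = {b. (b, \<one>\<^bsub>H\<^esub>) \<in> G}"
  obtain a where a: "a \<in> ?B" and M: "coprime_module H p M ?act" "M \<subseteq> ?B"
    and mem: "\<And>b h. b \<in> ?B \<Longrightarrow> h \<in> carrier H \<Longrightarrow> (b, h) \<in> G \<longleftrightarrow> b * ?act h a * B.minv a \<in> M"
    using B.subgroup_complement[OF G onto M_def] by blast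
  define \<kappa> where "\<kappa> = (\<lambda>(b, h). (b * ?act h a * B.minv a, h))"
  have \<kappa>_hom: "\<kappa> (v \<otimes>\<^bsub>?W\<^esub> w) = \<kappa> v \<otimes>\<^bsub>?W\<^esub> \<kappa> w" if "v \<in> carrier ?W" "w \<in> carrier ?W" for v w
  proof -
    obtain b h c k where vw: "v = (b, h)" "w = (c, k)" "b \<in> ?B" "c \<in> ?B" "h \<in> carrier H" "k \<in> carrier H"
      using \<open>v \<in> _\<close> \<open>w \<in> _\<close> by auto
    have "?act h a * ?act h (B.minv a) = 1"
      using vw a by (simp add: B.act_mult[symmetric] B.minv_closed B.minv_right B.act_one)
    then have "(b * ?act h c) * ?act (h \<otimes>\<^bsub>H\<^esub> k) a * B.minv a
        = (b * ?act h c) * ?act (h \<otimes>\<^bsub>H\<^esub> k) a * B.minv a * (?act h a * ?act h (B.minv a))" by simp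
    also have "\<dots> = (b * ?act h a * B.minv a) * ?act h (c * ?act k a * B.minv a)"
    proof -
      have "?act h (c * ?act k a * B.minv a) = ?act h c * ?act (h \<otimes>\<^bsub>H\<^esub> k) a * ?act h (B.minv a)"
        using vw a by (simp add: B.act_mult B.act_act B.mult_closed_B B.act_closed B.minv_closed)
      then show ?thesis by (simp only: ac_simps)
    qed
    finally show ?thesis by (simp add: vw \<kappa>_def)
  qed
  have \<kappa>_image: "\<kappa> ` G = M \<times> carrier H"
  proof
    show "\<kappa> ` G \<subseteq> M \<times> carrier H"
    proof (rule image_subsetI)
      fix w assume w: "w \<in> G"
      obtain b h where bh: "w = (b, h)" by (cases w)
      have "b \<in> ?B" "h \<in> carrier H" using w bh subgroup.subset[OF G] by auto
      then show "\<kappa> w \<in> M \<times> carrier H" using mem[of b h] w bh by (simp add: \<kappa>_def)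
    qed
    show "M \<times> carrier H \<subseteq> \<kappa> ` G"
    proof clarify
      fix m h assume m: "m \<in> M" and h: "h \<in> carrier H"
      let ?b = "m * a * B.minv (?act h a)"
      have bB: "?b \<in> ?B" using m h M(2) a by (intro B.mult_closed_B B.minv_closed B.act_closed) auto
      have "?b * ?act h a * B.minv a = m * (a * B.minv a) * (B.minv (?act h a) * ?act h a)"
        by (simp only: ac_simps)
      also have "\<dots> = m" using a h by (simp add: B.minv_left B.minv_right B.act_closed)
      finally have eq: "?b * ?act h a * B.minv a = m" .
      then have "(?b, h) \<in> G" using mem[OF bB h] m by simp
      then show "(m, h) \<in> \<kappa> ` G" using eq by (intro image_eqI[of _ _ "(?b, h)"]) (auto simp: \<kappa>_def)
    qed
  qed
  show ?thesis
  proof (rule that[of M ?act "\<kappa> \<circ> \<psi>"])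
    show "coprime_module H p M ?act" by fact
    show image: "(\<kappa> \<circ> \<psi>) ` carrier ?F = carrier (semidirect H M ?act)"
      using \<kappa>_image by (simp add: image_image G_def)
    show "\<kappa> \<circ> \<psi> \<in> hom ?F (semidirect H M ?act)"
    proof (rule homI)
      show "(\<kappa> \<circ> \<psi>) w \<in> carrier (semidirect H M ?act)" if "w \<in> carrier ?F" for w
        using that image by blast
      show "(\<kappa> \<circ> \<psi>) (v \<otimes>\<^bsub>?F\<^esub> w) = (\<kappa> \<circ> \<psi>) v \<otimes>\<^bsub>semidirect H M ?act\<^esub> (\<kappa> \<circ> \<psi>) w"
        if "v \<in> carrier ?F" "w \<in> carrier ?F" for v w
        using that \<kappa>_hom[OF \<psi>.hom_closed \<psi>.hom_closed] by (simp add: semidirect_def)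
    qed
    let ?E = "range (\<lambda>i. basis_element p (\<one>\<^bsub>H\<^esub>, i))"
    have "card ?B \<le> card M * p ^ card (carrier H)"
    proof (rule B.card_module_le[OF M a])
      show "?E \<subseteq> ?B" using basis_in by auto
      have "(\<Union>h\<in>carrier H. ?act h ` ?E) = basis_element p ` (carrier H \<times> UNIV)"
        by (force simp: translate_basis_element[OF H(1)] image_image)
      then show "?B \<subseteq> power_span (\<Union>h\<in>carrier H. ?act h ` ?E)"
        using free_module_span[OF H(2) B.p_pos] by simp
      fix e assume "e \<in> ?E"
      then obtain i where i: "e = basis_element p (\<one>\<^bsub>H\<^esub>, i)" by auto
      define n where "n = (if i then 1 else 0 :: nat)"
      have n: "n < d" using d by (simp add: n_def)
      have "(e, \<pi> [(n, True)]) = \<psi> [(n, True)]"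
        using \<psi>(2)[OF n] by (simp add: x_def i n_def)
      also have "\<dots> \<in> G" unfolding G_def using gen_F[OF n] by (rule imageI)
      finally show "\<exists>h\<in>carrier H. e * ?act h a * B.minv a \<in> M"
        using mem basis_in gen_F[OF n] i by (metis \<pi>.hom_closed)
    qed
    also have "card ?B = p ^ card (carrier H) * p ^ card (carrier H)"
      using free_module_card(2)[OF H(2) B.p_pos] by (simp add: mult_2 power_add)
    finally show "p ^ card (carrier H) \<le> card M" using B.p_pos by simp
  qed
qed


section \<open>Finite soluble quotients\<close>

lemma (in comm_group) comm_group_solvable: "solvable G"
  unfolding solvable_iff_trivial_derived_seq
  by (rule exI[of _ 1]) (simp add: derived_eq_singleton)

lemma (in coprime_module) solvable_semidirect:
  assumes "solvable H"
  shows "solvable (semidirect H B act)"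
proof -
  let ?A = "\<lparr>carrier = B, mult = (*), one = 1\<rparr> :: 'b monoid"
  have A: "comm_group ?A"
  proof (rule comm_groupI)
    show "\<exists>y\<in>carrier ?A. y \<otimes>\<^bsub>?A\<^esub> x = \<one>\<^bsub>?A\<^esub>" if "x \<in> carrier ?A" for x
      using that minv_left minv_closed by auto
  qed (auto simp: one_closed_B mult_closed_B ac_simps)
  have grA: "group ?A" using A by (simp add: comm_group_def)
  have "group_hom ?A (semidirect H B act) (\<lambda>b. (b, \<one>))"
    using grA group_semidirect
    by (intro group_hom.intro group_hom_axioms.intro homI) (auto simp: act_id)
  moreover have "group_hom (semidirect H B act) H snd"
    using group_semidirect is_group snd_hom by (intro group_hom.intro group_hom_axioms.intro)
  moreover have "snd ` carrier (semidirect H B act) = carrier H"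
    using one_closed_B by (force simp: image_iff)
  moreover have "kernel (semidirect H B act) H snd \<subseteq> (\<lambda>b. (b, \<one>)) ` carrier ?A"
    by (auto simp: kernel_def)
  ultimately show ?thesis
    using comm_group.comm_group_solvable[OF A] assms by (rule solvable_condition)
qed

lemma kernel_in_finite_soluble_quotients:
  assumes "group_hom G K f" and onto: "f ` carrier G = carrier K" and "finite (carrier K)" "solvable K"
  shows "kernel G K f \<in> finite_soluble_quotients G"
proof -
  interpret group_hom G K f by fact
  let ?Q = "G Mod kernel G K f"
  have iso: "(\<lambda>D. the_elem (f ` D)) \<in> iso ?Q K" using FactGroup_iso_set[OF onto] .
  then have "bij_betw (\<lambda>D. the_elem (f ` D)) (carrier ?Q) (carrier K)" by (simp add: iso_def)
  then have "finite (carrier ?Q)" "inj_on (\<lambda>D. the_elem (f ` D)) (carrier ?Q)"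
    using bij_betw_finite assms(3) by (auto simp: bij_betw_def)
  moreover have "group_hom ?Q K (\<lambda>D. the_elem (f ` D))"
    using normal.factorgroup_is_group[OF normal_kernel] H.is_group iso
    by (intro group_hom.intro group_hom_axioms.intro) (auto simp: iso_def)
  ultimately show ?thesis
    using group_hom.inj_hom_imp_solvable assms(4) normal_kernel
    by (auto simp: finite_soluble_quotients_def)
qed

lemma carrier_in_finite_soluble_quotients:
  assumes "group G"
  shows "carrier G \<in> finite_soluble_quotients G"
proof -
  let ?T = "singleton_group (\<one>\<^bsub>G\<^esub>)"
  have T: "comm_group ?T" by (rule singleton_abelian_group)
  then have "group_hom G ?T (\<lambda>_. \<one>\<^bsub>G\<^esub>)"
    using assms by (intro group_hom.intro group_hom_axioms.intro) (auto simp: comm_group_def hom_def singleton_group_def)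
  moreover have "(\<lambda>_. \<one>\<^bsub>G\<^esub>) ` carrier G = carrier ?T"
    using group.is_monoid[OF assms] monoid.one_closed by (force simp: singleton_group_def)
  moreover have "kernel G ?T (\<lambda>_. \<one>\<^bsub>G\<^esub>) = carrier G"
    by (auto simp: kernel_def singleton_group_def)
  ultimately show ?thesis
    using kernel_in_finite_soluble_quotients[of G ?T] comm_group.comm_group_solvable[OF T]
    by (metis carrier_singleton_group finite.simps)
qed

text \<open>
  Raising \<open>l\<close> by one costs one more extension: if \<open>g\<close> invariably generates the extension,
  its image in \<open>H\<close> has at least \<open>l\<close> members of large order. So if at most \<open>l\<close> members of \<open>g\<close>
  satisfy \<open>g i ^ N \<noteq> \<one>\<close>, these are the same ones.
\<close>

lemma quotient_without_invariable_generators: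
  fixes k :: nat
  assumes d: "d \<ge> 2" and N: "N > 0"
  shows "\<exists>R\<in>finite_soluble_quotients (free_group d). \<forall>g.
           card {i. i < k \<and> g i [^]\<^bsub>free_group d Mod R\<^esub> (N::nat) \<noteq> \<one>\<^bsub>free_group d Mod R\<^esub>} < l \<longrightarrow>
           \<not> invariable_generators (free_group d Mod R) k g"
  using N
proof (induction l arbitrary: N)
  case 0
  show ?case using carrier_in_finite_soluble_quotients[OF group_free_group] by auto
next
  case (Suc l)
  let ?F = "free_group d"
  interpret F: group ?F by (rule group_free_group)
  have "N * fact k > 0" using Suc.prems by simp
  from Suc.IH[OF this] obtain R where R: "R \<in> finite_soluble_quotients ?F"
    and IH: "\<And>h. invariable_generators (?F Mod R) k h \<Longrightarrow>
      l \<le> card {i. i < k \<and> h i [^]\<^bsub>?F Mod R\<^esub> (N * fact k) \<noteq> \<one>\<^bsub>?F Mod R\<^esub>}"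
    by (meson not_less)
  define H where "H = ?F Mod R"
  interpret R: normal R ?F using R by (simp add: finite_soluble_quotients_def)
  have H: "group H" "finite (carrier H)" "solvable H"
    using R R.factorgroup_is_group by (auto simp: H_def finite_soluble_quotients_def)
  have \<pi>: "(\<lambda>w. R #>\<^bsub>?F\<^esub> w) \<in> hom ?F H" "(\<lambda>w. R #>\<^bsub>?F\<^esub> w) ` carrier ?F = carrier H"
    using R.r_coset_hom_Mod by (auto simp: H_def FactGroup_def RCOSETS_def)
  have "card (carrier H) > 0"
    using H group.is_monoid monoid.one_closed by (fastforce simp: card_gt_0_iff)
  \<comment> \<open>coprime to the order of \<open>H\<close> for the splitting, and to \<open>N\<close> to control the short elements\<close>
  obtain p where p: "Factorial_Ring.prime p" "p > N + card (carrier H)"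
    using bigger_prime by blast
  have cop: "coprime p n" if "0 < n" "n \<le> N + card (carrier H)" for n
    using that p by (intro prime_imp_coprime) (auto dest: dvd_imp_le)
  have copH: "coprime p (card (carrier H))" and copN: "coprime p N"
    using cop \<open>card (carrier H) > 0\<close> Suc.prems by auto
  obtain M :: "(letter list set \<times> bool \<Rightarrow> complex) set" and act \<phi> where
    M: "coprime_module H p M act" "p ^ card (carrier H) \<le> card M" and
    \<phi>: "\<phi> \<in> hom ?F (semidirect H M act)" "\<phi> ` carrier ?F = carrier (semidirect H M act)"
    using large_split_extension[OF H(1,2) \<pi> d p(1) copH] by blast
  interpret M: coprime_module H p M act by (rule M(1))
  let ?E = "semidirect H M act"
  interpret \<phi>: group_hom ?F ?E \<phi>
    using F.is_group M.group_semidirect \<phi>(1) by (intro group_hom.intro group_hom_axioms.intro)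
  let ?K = "kernel ?F ?E \<phi>"
  have K: "?K \<in> finite_soluble_quotients ?F"
    using \<phi>.group_hom_axioms \<phi>(2) M.finite_semidirect M.solvable_semidirect[OF H(3)]
    by (rule kernel_in_finite_soluble_quotients)
  let ?\<theta> = "\<lambda>D. the_elem (\<phi> ` D)"
  have \<theta>: "group_hom (?F Mod ?K) ?E ?\<theta>" "?\<theta> ` carrier (?F Mod ?K) = carrier ?E"
    using \<phi>.FactGroup_iso_set[OF \<phi>(2)] normal.factorgroup_is_group[OF \<phi>.normal_kernel]
      M.group_semidirect
    by (auto simp: iso_def bij_betw_def intro!: group_hom.intro group_hom_axioms.intro)
  interpret \<theta>: group_hom "?F Mod ?K" ?E ?\<theta> by (rule \<theta>(1))
  have sndM: "group_hom ?E H snd" "snd ` carrier ?E = carrier H"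
    using M.group_semidirect H(1) M.snd_hom M.one_closed_B
    by (auto intro!: group_hom.intro group_hom_axioms.intro simp: image_iff)
  show ?case
  proof (intro bexI[OF _ K] allI impI notI)
    fix g
    let ?A = "{i. i < k \<and> g i [^]\<^bsub>?F Mod ?K\<^esub> N \<noteq> \<one>\<^bsub>?F Mod ?K\<^esub>}"
    assume A: "card ?A < Suc l" and gen: "invariable_generators (?F Mod ?K) k g"
    let ?g = "?\<theta> \<circ> g"
    have gen_E: "invariable_generators ?E k ?g"
      by (rule invariable_generators_image[OF \<theta> gen])
    then have g: "?g \<in> {..<k} \<rightarrow> carrier ?E" by (simp add: invariable_generators_def)
    have g_in: "g i \<in> carrier (?F Mod ?K)" if "i < k" for i
      using gen that by (auto simp: invariable_generators_def)
    let ?A' = "{i. i < k \<and> (snd \<circ> ?g) i [^]\<^bsub>H\<^esub> (N * fact k) \<noteq> \<one>\<^bsub>H\<^esub>}"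
    have "l \<le> card ?A'"
      using IH[OF invariable_generators_image[OF sndM gen_E, unfolded H_def]] by (simp add: H_def)
    have pow_E: "?g i [^]\<^bsub>?E\<^esub> N = \<one>\<^bsub>?E\<^esub>" if "i < k" "g i [^]\<^bsub>?F Mod ?K\<^esub> N = \<one>\<^bsub>?F Mod ?K\<^esub>" for i
      using that \<theta>.hom_nat_pow[OF g_in[OF that(1)], of N] \<theta>.hom_one by simp
    have pow_H: "(snd \<circ> ?g) i [^]\<^bsub>H\<^esub> (N * fact k) = \<one>\<^bsub>H\<^esub>" if i: "i < k" and one: "?g i [^]\<^bsub>?E\<^esub> N = \<one>\<^bsub>?E\<^esub>" for i
    proof -
      have c: "?g i \<in> carrier ?E" by (rule funcset_mem[OF g]) (simp add: i)
      then have "snd (?g i) [^]\<^bsub>H\<^esub> N = \<one>\<^bsub>H\<^esub>"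
        using M.snd_power[OF c, of N] one by simp
      moreover have "snd (?g i) \<in> carrier H" using c by auto
      ultimately show ?thesis
        using M.nat_pow_pow[of "snd (?g i)" N "fact k"] by simp
    qed
    have "?A' \<subseteq> ?A" using pow_E pow_H by blast
    moreover have "finite ?A" by simp
    ultimately have "?A' = ?A" using \<open>l \<le> card ?A'\<close> A by (intro card_seteq) auto
    then have long: "snd (?g i) [^]\<^bsub>H\<^esub> (N * fact k) \<noteq> \<one>\<^bsub>H\<^esub>"
      if "i < k" "?g i [^]\<^bsub>?E\<^esub> N \<noteq> \<one>\<^bsub>?E\<^esub>" for i
      using that pow_E[of i] by auto
    show False
      using M.not_invariable_generators_semidirect[OF M(2) copN g long] gen_E by blast
  qed
qed


section \<open>The prosoluble completion\<close>

lemma completion_projection_hom: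
  assumes "group G" "N \<in> finite_soluble_quotients G"
  shows "group_hom (prosoluble_completion G) (G Mod N) (\<lambda>x. x N)"
proof (intro group_hom.intro group_hom_axioms.intro homI)
  show "group (prosoluble_completion G)" using assms(1) by (rule group_prosoluble_completion)
  show "group (G Mod N)"
    using assms(2) by (simp add: finite_soluble_quotients_def normal.factorgroup_is_group)
qed (use assms(2) in \<open>auto simp: prosoluble_completion_def product_group_def\<close>)

lemma completion_projection_onto:
  assumes "group G" "N \<in> finite_soluble_quotients G"
  shows "(\<lambda>x. x N) ` carrier (prosoluble_completion G) = carrier (G Mod N)"
proof
  show "(\<lambda>x. x N) ` carrier (prosoluble_completion G) \<subseteq> carrier (G Mod N)"
    using group_hom.hom_closed[OF completion_projection_hom[OF assms]] by blast
  show "carrier (G Mod N) \<subseteq> (\<lambda>x. x N) ` carrier (prosoluble_completion G)"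
  proof
    fix C assume "C \<in> carrier (G Mod N)"
    then obtain g where g: "g \<in> carrier G" "C = N #>\<^bsub>G\<^esub> g"
      by (auto simp: FactGroup_def RCOSETS_def)
    let ?x = "\<lambda>M\<in>finite_soluble_quotients G. M #>\<^bsub>G\<^esub> g"
    have "?x \<in> carrier (prosoluble_completion G)"
      using g transition_hom(2)[OF _ _ _ g(1)]
      by (auto simp: prosoluble_completion_def finite_soluble_quotients_def FactGroup_def RCOSETS_def)
    then show "C \<in> (\<lambda>x. x N) ` carrier (prosoluble_completion G)"
      using g assms(2) by (intro image_eqI[of _ _ ?x]) auto
  qed
qed

text \<open>The fibres of the projections are open, so a dense subset meets all of them.\<close>

lemma completion_projection_dense:
  assumes "group G" and N: "N \<in> finite_soluble_quotients G"
    and dense: "prosoluble_completion_topology G closure_of Y = carrier (prosoluble_completion G)"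
  shows "carrier (G Mod N) \<subseteq> (\<lambda>x. x N) ` Y"
proof
  let ?T = "prosoluble_completion_topology G"
  fix C assume C: "C \<in> carrier (G Mod N)"
  then have "C \<in> (\<lambda>x. x N) ` carrier (prosoluble_completion G)"
    using completion_projection_onto[OF assms(1) N] by simp
  then obtain z where z: "z \<in> carrier (prosoluble_completion G)" "z N = C" by blast
  have "continuous_map ?T (discrete_topology (carrier (G Mod N))) (\<lambda>x. x N)"
    unfolding prosoluble_completion_topology_def
    by (intro continuous_map_from_subtopology continuous_map_product_projection N)
  then have "openin ?T {x \<in> topspace ?T. x N \<in> {C}}"
    by (rule openin_continuous_map_preimage) (use C in simp)
  then have fibre: "openin ?T {x \<in> carrier (prosoluble_completion G). x N = C}" by simp
  have "z \<in> ?T closure_of Y" using dense z(1) by simp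
  then have "\<exists>y. y \<in> Y \<and> y \<in> {x \<in> carrier (prosoluble_completion G). x N = C}"
    using z fibre by (intro in_closure_of[THEN iffD1, THEN conjunct2, rule_format] conjI fibre) auto
  then obtain y where "y \<in> Y" "y N = C" by blast
  then show "C \<in> (\<lambda>x. x N) ` Y" by auto
qed

text \<open>
  Conjugators in a finite quotient lift to the completion, where the conjugated set generates a
  dense subgroup, which maps onto the quotient.
\<close>

lemma FIG_prosoluble_completion_imp:
  assumes G: "group G" and "FIG (prosoluble_completion G) (prosoluble_completion_topology G)"
  obtains k where
    "\<And>N. N \<in> finite_soluble_quotients G \<Longrightarrow> \<exists>g. invariable_generators (G Mod N) k g"
proof -
  let ?C = "prosoluble_completion G" and ?T = "prosoluble_completion_topology G"
  obtain S where fin: "finite S" and S: "invariably_generates ?C ?T S"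
    using assms(2) by (auto simp: FIG_def)
  define k where "k = card S"
  obtain s where s: "bij_betw s {..<k} S"
    using ex_bij_betw_nat_finite[OF fin] by (auto simp: k_def atLeast0LessThan)
  have s_in: "s i \<in> carrier ?C" if "i < k" for i
    using S bij_betw_apply[OF s] that by (auto simp: invariably_generates_def)
  interpret C: group ?C by (rule group_prosoluble_completion[OF G])
  have "invariable_generators (G Mod N) k (\<lambda>i. s i N)" if N: "N \<in> finite_soluble_quotients G" for N
    unfolding invariable_generators_def
  proof (intro conjI ballI)
    interpret e: group_hom ?C "G Mod N" "\<lambda>x. x N" by (rule completion_projection_hom[OF G N])
    note onto = completion_projection_onto[OF G N]
    show "(\<lambda>i. s i N) \<in> {..<k} \<rightarrow> carrier (G Mod N)" using s_in e.hom_closed by auto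
    fix c assume c: "c \<in> {..<k} \<rightarrow> carrier (G Mod N)"
    define c' where "c' i = inv_into (carrier ?C) (\<lambda>x. x N) (c i)" for i
    have c': "c' i \<in> carrier ?C" "c' i N = c i" if "i < k" for i
    proof -
      have "c i \<in> (\<lambda>x. x N) ` carrier ?C" using c that onto by auto
      then show "c' i \<in> carrier ?C" "c' i N = c i"
        unfolding c'_def by (auto simp: inv_into_into f_inv_into_f[where f = "\<lambda>x. x N"])
    qed
    define \<gamma> where "\<gamma> x = c' (the_inv_into {..<k} s x)" for x
    have \<gamma>: "\<gamma> (s i) = c' i" if "i < k" for i
      using s that by (simp add: \<gamma>_def bij_betw_def the_inv_into_f_f)
    have S_eq: "S = s ` {..<k}" using s by (simp add: bij_betw_def)
    let ?X = "(\<lambda>x. inv\<^bsub>?C\<^esub> \<gamma> x \<otimes>\<^bsub>?C\<^esub> x \<otimes>\<^bsub>?C\<^esub> \<gamma> x) ` S"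
    have "\<gamma> \<in> S \<rightarrow> carrier ?C" unfolding S_eq using \<gamma> c' by auto
    then have "topologically_generates ?C ?T ?X"
      using S by (simp add: invariably_generates_def)
    then have X: "?X \<subseteq> carrier ?C" and dense: "?T closure_of (generate ?C ?X) = carrier ?C"
      by (auto simp: topologically_generates_def)
    have "generate (G Mod N) ((\<lambda>x. x N) ` ?X) = (\<lambda>x. x N) ` generate ?C ?X"
      by (rule e.generate_img[OF X])
    moreover have "(\<lambda>x. x N) ` generate ?C ?X \<subseteq> carrier (G Mod N)"
      using C.generate_incl[OF X] e.hom_closed by blast
    ultimately have "generate (G Mod N) ((\<lambda>x. x N) ` ?X) = carrier (G Mod N)"
      using completion_projection_dense[OF G N dense] by (simp only: subset_antisym)
    moreover have "(\<lambda>x. x N) ` ?X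
        = (\<lambda>i. inv\<^bsub>G Mod N\<^esub> c i \<otimes>\<^bsub>G Mod N\<^esub> s i N \<otimes>\<^bsub>G Mod N\<^esub> c i) ` {..<k}"
      unfolding S_eq image_image
    proof (rule image_cong[OF refl])
      fix i assume "i \<in> {..<k}"
      then have "s i \<in> carrier ?C" "\<gamma> (s i) \<in> carrier ?C" "\<gamma> (s i) N = c i"
        using s_in c' \<gamma> by auto
      then show "(inv\<^bsub>?C\<^esub> \<gamma> (s i) \<otimes>\<^bsub>?C\<^esub> s i \<otimes>\<^bsub>?C\<^esub> \<gamma> (s i)) N
          = inv\<^bsub>G Mod N\<^esub> c i \<otimes>\<^bsub>G Mod N\<^esub> s i N \<otimes>\<^bsub>G Mod N\<^esub> c i"
        by (simp add: e.hom_mult e.hom_inv)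
    qed
    ultimately show "generate (G Mod N)
        ((\<lambda>i. inv\<^bsub>G Mod N\<^esub> c i \<otimes>\<^bsub>G Mod N\<^esub> s i N \<otimes>\<^bsub>G Mod N\<^esub> c i) ` {..<k}) = carrier (G Mod N)"
      by simp
  qed
  then show ?thesis by (intro that) blast
qed

theorem theorem1:
  fixes d :: nat
  assumes "d \<ge> 2"
  shows "\<not> FIG (free_prosoluble_group d) (free_prosoluble_topology d)"
proof
  assume "FIG (free_prosoluble_group d) (free_prosoluble_topology d)"
  then obtain k where k: "\<And>R. R \<in> finite_soluble_quotients (free_group d) \<Longrightarrow>
      \<exists>g. invariable_generators (free_group d Mod R) k g"
    unfolding free_prosoluble_group_def free_prosoluble_topology_def
    using FIG_prosoluble_completion_imp[OF group_free_group] by blast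
  obtain R where R: "R \<in> finite_soluble_quotients (free_group d)"
    and few: "\<And>g. card {i. i < k \<and> g i [^]\<^bsub>free_group d Mod R\<^esub> (1::nat) \<noteq> \<one>\<^bsub>free_group d Mod R\<^esub>} < Suc k
      \<Longrightarrow> \<not> invariable_generators (free_group d Mod R) k g"
    using quotient_without_invariable_generators[OF assms, of 1 k "Suc k"] by auto
  have "card {i. i < k \<and> P i} < Suc k" for P
    using card_mono[of "{..<k}" "{i. i < k \<and> P i}"] by (simp add: subset_iff less_Suc_eq_le)
  then have "\<not> invariable_generators (free_group d Mod R) k g" for g by (rule few)
  then show False using k[OF R] by blast
qed

end
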